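(* The problem $\mathrm{Synthesis}(\mathrm{FO}^2[\sim,<,+1],\{0\},\{0\},\mathbb{N})$ is undecidable. That is, there is no algorithm that, given a finite alphabet $A=A_s\uplus A_e$ and a sentence $\varphi$ of the two-variable fragment $\mathrm{FO}^2_A[\sim,<,+1]$, decides whether there exists $k\in\mathbb{N}$ with $(0,0,k)\in\mathrm{Win}(\varphi)$.
   Context: Process types: $\mathbb{T}=\{s,e,se\}$ (System, Environment, both). A process triple $\mathbb{P}=(\mathbb{P}_s,\mathbb{P}_e,\mathbb{P}_{se})$ consists of pairwise disjoint finite sets; $\mathbb{P}$ also denotes their union. A finite action alphabet is partitioned as $A=A_s\uplus A_e$. Events: $\Sigma_s=A_s\times(\mathbb{P}_s\cup\mathbb{P}_{se})$, $\Sigma_e=A_e\times(\mathbb{P}_e\cup\mathbb{P}_{se})$, $\Sigma=\Sigma_s\cup\Sigma_e$. A $\mathbb{P}$-execution is a word $w\in\Sigma^*\cup\Sigma^\omega$; $\mathrm{Pos}(w)$ is its set of positions ($\{1,\dots,|w|\}$ or $\{1,2,\dots\}$). Logic $\mathrm{FO}_A[\sim,<,+1]$: $\varphi::=\theta(x)\mid a(x)\mid x=y\mid x\sim y\mid x<y\mid +1(x,y)\mid\neg\varphi\mid\varphi\vee\varphi\mid\exists x.\varphi$ with $\theta\in\mathbb{T}$, $a\in A$. It is evaluated on $(\mathbb{P},w)$ with $w=(a_1,p_1)(a_2,p_2)\dots$ viewed as the structure with universe $\mathbb{P}\uplus\mathrm{Pos}(w)$, where $\theta$ is interpreted as $\mathbb{P}_\theta$,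 $a$ as $\{i\in\mathrm{Pos}(w)\mid a_i=a\}$, $<$ and $+1$ as the order and successor on positions, and $\sim$ as the least equivalence relation on $\mathbb{P}\uplus\mathrm{Pos}(w)$ containing $(p,i)$ whenever $p=p_i$ and $(i,j)$ whenever $p_i=p_j$. $\mathrm{FO}^2_A[\sim,<,+1]$ is the fragment using only two (reusable) variable names. A $\mathbb{P}$-strategy is a map $f:\Sigma^*\to\Sigma_s\cup\{\varepsilon\}$. An execution $w=\sigma_1\sigma_2\dots$ is $f$-compatible if $f(\sigma_1\dots\sigma_{i-1})=\sigma_i$ for every $i$ with $\sigma_i\in\Sigma_s$; it is $f$-fair if (i) when $w$ is finite, $f(w)=\varepsilon$, and (ii) when $w$ is infinite and $f(\sigma_1\dots\sigma_{i-1})\ne\varepsilon$ for infinitely many $i$, then $\sigma_j\in\Sigma_s$ for infinitely many $j$. $f$ is $\mathbb{P}$-winning for a sentence $\varphi$ if every $f$-compatible, $f$-fair $\mathbb{P}$-execution $w$ satisfies $(\mathbb{P},w)\models\varphi$. $\mathrm{Win}(\varphi)$ is the set of $(k_s,k_e,k_{se})\in\mathbb{N}^3$ such that for some $\mathbb{P}$ with $|\mathbb{P}_\theta|=k_\theta$ ($\theta\in\mathbb{T}$) there is a $\mathbb{P}$-strategy that is $\mathbb{P}$-winning for $\varphi$. For a logic fragment $\mathfrak{F}[R]$ and sets $N_s,N_e,N_{se}\subseteq\mathbb{N}$, $\mathrm{Synthesis}(\mathfrak{F}[R],N_s,N_e,N_{se})$ asks, given $A=A_s\uplus A_e$ and a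 sentence $\varphi\in\mathfrak{F}_A[R]$, whether $\mathrm{Win}(\varphi)\cap(N_s\times N_e\times N_{se})\neq\emptyset$. *)

theory Defs
  imports Main "HOL-Library.Nat_Bijection"
begin

section \<open>Executions\<close>

datatype ptype = Sys | Env | SysEnv

type_synonym 'p procs = "ptype \<Rightarrow> 'p set"
type_synonym 'p event = "nat \<times> 'p"

definition process_triple :: "'p procs \<Rightarrow> bool" where
  "process_triple P \<longleftrightarrow> (\<forall>\<theta>. finite (P \<theta>)) \<and> (\<forall>\<theta> \<theta>'. \<theta> \<noteq> \<theta>' \<longrightarrow> P \<theta> \<inter> P \<theta>' = {})"

definition procs :: "'p procs \<Rightarrow> 'p set" where
  "procs P = (\<Union>\<theta>. P \<theta>)"

definition sys_events :: "nat set \<Rightarrow> 'p procs \<Rightarrow> 'p event set" where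
  "sys_events As P = As \<times> (P Sys \<union> P SysEnv)"

definition env_events :: "nat set \<Rightarrow> 'p procs \<Rightarrow> 'p event set" where
  "env_events Ae P = Ae \<times> (P Env \<union> P SysEnv)"

definition events :: "nat set \<Rightarrow> nat set \<Rightarrow> 'p procs \<Rightarrow> 'p event set" where
  "events As Ae P = sys_events As P \<union> env_events Ae P"

datatype 'e word = Fin "'e list" | Inf "nat \<Rightarrow> 'e"

text \<open>Positions are numbered from 1, whereas the list and the function stored in a word are
  indexed from 0. \<open>prefix w n\<close> consists of the first \<open>n\<close> letters.\<close>

fun positions :: "'e word \<Rightarrow> nat set" where
  "positions (Fin u) = {1..length u}"
| "positions (Inf v) = {1..}"

fun letter :: "'e word \<Rightarrow> nat \<Rightarrow> 'e" where
  "letter (Fin u) i = u ! (i - 1)"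
| "letter (Inf v) i = v (i - 1)"

fun prefix :: "'e word \<Rightarrow> nat \<Rightarrow> 'e list" where
  "prefix (Fin u) n = take n u"
| "prefix (Inf v) n = map v [0..<n]"

definition execution :: "nat set \<Rightarrow> nat set \<Rightarrow> 'p procs \<Rightarrow> 'p event word \<Rightarrow> bool" where
  "execution As Ae P w \<longleftrightarrow> (\<forall>i\<in>positions w. letter w i \<in> events As Ae P)"

section \<open>First-order logic over executions\<close>

text \<open>Variables and actions are natural numbers.\<close>

datatype fm =
    Type ptype nat
  | Act nat nat
  | Eq nat nat
  | Sim nat nat
  | Less nat nat
  | Succ nat nat
  | Neg fm
  | Or fm fm
  | Ex nat fm

primrec vars :: "fm \<Rightarrow> nat set" where
  "vars (Type \<theta> x) = {x}"
| "vars (Act a x) = {x}"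
| "vars (Eq x y) = {x, y}"
| "vars (Sim x y) = {x, y}"
| "vars (Less x y) = {x, y}"
| "vars (Succ x y) = {x, y}"
| "vars (Neg \<phi>) = vars \<phi>"
| "vars (Or \<phi> \<psi>) = vars \<phi> \<union> vars \<psi>"
| "vars (Ex x \<phi>) = insert x (vars \<phi>)"

primrec free_vars :: "fm \<Rightarrow> nat set" where
  "free_vars (Type \<theta> x) = {x}"
| "free_vars (Act a x) = {x}"
| "free_vars (Eq x y) = {x, y}"
| "free_vars (Sim x y) = {x, y}"
| "free_vars (Less x y) = {x, y}"
| "free_vars (Succ x y) = {x, y}"
| "free_vars (Neg \<phi>) = free_vars \<phi>"
| "free_vars (Or \<phi> \<psi>) = free_vars \<phi> \<union> free_vars \<psi>"
| "free_vars (Ex x \<phi>) = free_vars \<phi> - {x}"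

primrec actions :: "fm \<Rightarrow> nat set" where
  "actions (Type \<theta> x) = {}"
| "actions (Act a x) = {a}"
| "actions (Eq x y) = {}"
| "actions (Sim x y) = {}"
| "actions (Less x y) = {}"
| "actions (Succ x y) = {}"
| "actions (Neg \<phi>) = actions \<phi>"
| "actions (Or \<phi> \<psi>) = actions \<phi> \<union> actions \<psi>"
| "actions (Ex x \<phi>) = actions \<phi>"

definition sentence :: "fm \<Rightarrow> bool" where
  "sentence \<phi> \<longleftrightarrow> free_vars \<phi> = {}"

definition FO :: "nat set \<Rightarrow> fm set" where
  "FO A = {\<phi>. actions \<phi> \<subseteq> A}"

definition FO2 :: "nat set \<Rightarrow> fm set" where
  "FO2 A = {\<phi> \<in> FO A. card (vars \<phi>) \<le> 2}"

definition universe :: "'p procs \<Rightarrow> 'p event word \<Rightarrow> ('p + nat) set" where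
  "universe P w = procs P <+> positions w"

definition same_proc :: "'p procs \<Rightarrow> 'p event word \<Rightarrow> (('p + nat) \<times> ('p + nat)) set" where
  "same_proc P w = \<Inter>{r. equiv (universe P w) r \<and>
     {(Inl (snd (letter w i)), Inr i) | i. i \<in> positions w} \<subseteq> r \<and>
     {(Inr i, Inr j) | i j. i \<in> positions w \<and> j \<in> positions w \<and>
        snd (letter w i) = snd (letter w j)} \<subseteq> r}"

primrec sat :: "'p procs \<Rightarrow> 'p event word \<Rightarrow> (nat \<Rightarrow> 'p + nat) \<Rightarrow> fm \<Rightarrow> bool" where
  "sat P w \<nu> (Type \<theta> x) \<longleftrightarrow> \<nu> x \<in> Inl ` P \<theta>"
| "sat P w \<nu> (Act a x) \<longleftrightarrow> \<nu> x \<in> Inr ` {i \<in> positions w. fst (letter w i) = a}"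
| "sat P w \<nu> (Eq x y) \<longleftrightarrow> \<nu> x = \<nu> y"
| "sat P w \<nu> (Sim x y) \<longleftrightarrow> (\<nu> x, \<nu> y) \<in> same_proc P w"
| "sat P w \<nu> (Less x y) \<longleftrightarrow>
     (\<exists>i\<in>positions w. \<exists>j\<in>positions w. \<nu> x = Inr i \<and> \<nu> y = Inr j \<and> i < j)"
| "sat P w \<nu> (Succ x y) \<longleftrightarrow>
     (\<exists>i\<in>positions w. \<exists>j\<in>positions w. \<nu> x = Inr i \<and> \<nu> y = Inr j \<and> j = i + 1)"
| "sat P w \<nu> (Neg \<phi>) \<longleftrightarrow> \<not> sat P w \<nu> \<phi>"
| "sat P w \<nu> (Or \<phi> \<psi>) \<longleftrightarrow> sat P w \<nu> \<phi> \<or> sat P w \<nu> \<psi>"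
| "sat P w \<nu> (Ex x \<phi>) \<longleftrightarrow> (\<exists>d\<in>universe P w. sat P w (\<nu>(x := d)) \<phi>)"

text \<open>The truth value of a sentence does not depend on the valuation. The valuation is deliberately
  not required to take values in the universe, which is empty if there are no processes.\<close>

definition models :: "'p procs \<Rightarrow> 'p event word \<Rightarrow> fm \<Rightarrow> bool" where
  "models P w \<phi> \<longleftrightarrow> (\<forall>\<nu>. sat P w \<nu> \<phi>)"

lemma sat_cong_free_vars:
  "(\<And>x. x \<in> free_vars \<phi> \<Longrightarrow> \<nu> x = \<nu>' x) \<Longrightarrow> sat P w \<nu> \<phi> \<longleftrightarrow> sat P w \<nu>' \<phi>"
proof (induction \<phi> arbitrary: \<nu> \<nu>')
  case (Neg \<phi>)
  have "sat P w \<nu> \<phi> \<longleftrightarrow> sat P w \<nu>' \<phi>"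
    by (rule Neg.IH) (rule Neg.prems, simp)
  then show ?case by simp
next
  case (Or \<phi> \<psi>)
  have "sat P w \<nu> \<phi> \<longleftrightarrow> sat P w \<nu>' \<phi>"
    by (rule Or.IH(1)) (rule Or.prems, simp)
  moreover have "sat P w \<nu> \<psi> \<longleftrightarrow> sat P w \<nu>' \<psi>"
    by (rule Or.IH(2)) (rule Or.prems, simp)
  ultimately show ?case by simp
next
  case (Ex x \<phi>)
  have "sat P w (\<nu>(x := d)) \<phi> \<longleftrightarrow> sat P w (\<nu>'(x := d)) \<phi>" for d
  proof (rule Ex.IH)
    fix y
    assume "y \<in> free_vars \<phi>"
    then show "(\<nu>(x := d)) y = (\<nu>'(x := d)) y"
      using Ex.prems[of y] by (cases "y = x") simp_all
  qed
  then show ?case by simp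
next
  case (Eq x y)
  from Eq[of x] Eq[of y] show ?case by simp
next
  case (Type \<theta> x)
  from Type[of x] show ?case by simp
next
  case (Act a x)
  from Act[of x] show ?case by simp
next
  case (Sim x y)
  from Sim[of x] Sim[of y] show ?case by simp
next
  case (Less x y)
  from Less[of x] Less[of y] show ?case by simp
next
  case (Succ x y)
  from Succ[of x] Succ[of y] show ?case by simp
qed

lemma models_sentence_iff: "sentence \<phi> \<Longrightarrow> models P w \<phi> \<longleftrightarrow> sat P w \<nu> \<phi>"
proof -
  assume "sentence \<phi>"
  then have "sat P w \<nu>' \<phi> \<longleftrightarrow> sat P w \<nu> \<phi>" for \<nu>'
    by (intro sat_cong_free_vars) (simp add: sentence_def)
  then show ?thesis unfolding models_def by blast
qed

section \<open>Strategies\<close>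

text \<open>The value \<open>None\<close> of a strategy stands for \<open>\<epsilon>\<close>.\<close>

definition strategy ::
  "nat set \<Rightarrow> nat set \<Rightarrow> 'p procs \<Rightarrow> ('p event list \<Rightarrow> 'p event option) \<Rightarrow> bool" where
  "strategy As Ae P f \<longleftrightarrow>
     (\<forall>u\<in>lists (events As Ae P). f u \<in> Some ` sys_events As P \<union> {None})"

definition compatible ::
  "nat set \<Rightarrow> 'p procs \<Rightarrow> ('p event list \<Rightarrow> 'p event option) \<Rightarrow> 'p event word \<Rightarrow> bool" where
  "compatible As P f w \<longleftrightarrow>
     (\<forall>i\<in>positions w. letter w i \<in> sys_events As P \<longrightarrow> f (prefix w (i - 1)) = Some (letter w i))"

fun fair ::
  "nat set \<Rightarrow> 'p procs \<Rightarrow> ('p event list \<Rightarrow> 'p event option) \<Rightarrow> 'p event word \<Rightarrow> bool" where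
  "fair As P f (Fin u) \<longleftrightarrow> f u = None"
| "fair As P f (Inf v) \<longleftrightarrow>
     (infinite {i \<in> positions (Inf v). f (prefix (Inf v) (i - 1)) \<noteq> None} \<longrightarrow>
      infinite {j \<in> positions (Inf v). letter (Inf v) j \<in> sys_events As P})"

definition winning ::
  "nat set \<Rightarrow> nat set \<Rightarrow> 'p procs \<Rightarrow> fm \<Rightarrow> ('p event list \<Rightarrow> 'p event option) \<Rightarrow> bool" where
  "winning As Ae P \<phi> f \<longleftrightarrow>
     (\<forall>w. execution As Ae P w \<and> compatible As P f w \<and> fair As P f w \<longrightarrow> models P w \<phi>)"

text \<open>Only the number of processes matters, so process names are drawn from the natural numbers.\<close>

definition Win :: "nat set \<Rightarrow> nat set \<Rightarrow> fm \<Rightarrow> (nat \<times> nat \<times> nat) set" where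
  "Win As Ae \<phi> = {(ks, ke, kse). \<exists>P :: nat procs. process_triple P \<and>
     card (P Sys) = ks \<and> card (P Env) = ke \<and> card (P SysEnv) = kse \<and>
     (\<exists>f. strategy As Ae P f \<and> winning As Ae P \<phi> f)}"

section \<open>Decidability\<close>

text \<open>Algorithms are Kleene's partial recursive functions. In primitive recursion and minimisation
  the distinguished argument comes first; minimisation requires the function to be defined at
  all smaller arguments.\<close>

datatype recf =
    RZero
  | RSucc
  | RProj nat
  | RComp recf "recf list"
  | RPrec recf recf
  | RMin recf

inductive computes :: "recf \<Rightarrow> nat list \<Rightarrow> nat \<Rightarrow> bool" where
  zero: "computes RZero xs 0"
| succ: "computes RSucc [x] (Suc x)"
| proj: "i < length xs \<Longrightarrow> computes (RProj i) xs (xs ! i)"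
| comp: "list_all2 (\<lambda>g y. computes g xs y) gs ys \<Longrightarrow> computes f ys z \<Longrightarrow>
    computes (RComp f gs) xs z"
| prec_0: "computes f xs z \<Longrightarrow> computes (RPrec f g) (0 # xs) z"
| prec_Suc: "computes (RPrec f g) (n # xs) y \<Longrightarrow> computes g (n # y # xs) z \<Longrightarrow>
    computes (RPrec f g) (Suc n # xs) z"
| min: "computes f (n # xs) 0 \<Longrightarrow> (\<And>m. m < n \<Longrightarrow> \<exists>k. computes f (m # xs) (Suc k)) \<Longrightarrow>
    computes (RMin f) xs n"

inductive_cases computes_RZeroE: "computes RZero xs z"
inductive_cases computes_RSuccE: "computes RSucc xs z"
inductive_cases computes_RProjE: "computes (RProj i) xs z"
inductive_cases computes_RCompE: "computes (RComp f gs) xs z"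
inductive_cases computes_RPrec_0E: "computes (RPrec f g) (0 # xs) z"
inductive_cases computes_RPrec_SucE: "computes (RPrec f g) (Suc n # xs) z"
inductive_cases computes_RMinE: "computes (RMin f) xs z"

lemma computes_deterministic:
  "computes f xs y \<Longrightarrow> computes f xs z \<Longrightarrow> y = z"
proof (induction arbitrary: z rule: computes.induct)
  case (zero xs)
  then show ?case by (rule computes_RZeroE) simp
next
  case (succ x)
  then show ?case by (rule computes_RSuccE) simp
next
  case (proj i xs)
  from proj.prems show ?case by (rule computes_RProjE) simp
next
  case (comp xs gs ys f y)
  from comp.prems obtain zs
    where zs: "list_all2 (\<lambda>g y. computes g xs y) gs zs" "computes f zs z"
    by (rule computes_RCompE)
  have "ys = zs"
  proof (rule nth_equalityI)
    show len: "length ys = length zs"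
      using list_all2_lengthD[OF comp.IH(1)] list_all2_lengthD[OF zs(1)] by linarith
    show "ys ! i = zs ! i" if "i < length ys" for i
    proof -
      have "i < length zs" using that len by linarith
      then have "computes (gs ! i) xs (zs ! i)" by (rule list_all2_nthD2[OF zs(1)])
      then show ?thesis using list_all2_nthD2[OF comp.IH(1) that] by blast
    qed
  qed
  with zs(2) have "computes f ys z" by (simp only:)
  then show ?case by (rule comp.IH(2))
next
  case (prec_0 f xs y g)
  from prec_0.prems have "computes f xs z" by (rule computes_RPrec_0E)
  then show ?case by (rule prec_0.IH)
next
  case (prec_Suc f g n xs y u)
  from prec_Suc.prems obtain y'
    where y': "computes (RPrec f g) (n # xs) y'" "computes g (n # y' # xs) z"
    by (rule computes_RPrec_SucE)
  from y'(1) have "y = y'" by (rule prec_Suc.IH(1))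
  with y'(2) have "computes g (n # y # xs) z" by (simp only:)
  then show ?case by (rule prec_Suc.IH(2))
next
  case (min f n xs)
  from min.prems have z0: "computes f (z # xs) 0" by (rule computes_RMinE)
  from min.prems have zk: "\<exists>k. computes f (m # xs) (Suc k)" if "m < z" for m
    by (rule computes_RMinE) (use that in blast)
  show ?case
  proof (cases n z rule: linorder_cases)
    case less
    then obtain k where "computes f (n # xs) (Suc k)" using zk by blast
    then have "0 = Suc k" by (rule min.IH(1))
    then show ?thesis by simp
  next
    case greater
    then obtain k where k: "\<And>y. computes f (z # xs) y \<Longrightarrow> Suc k = y" using min.IH(2) by blast
    from z0 have "Suc k = 0" by (rule k)
    then show ?thesis by simp
  qed
qed

text \<open>A decision problem consists of its instances, the instances with answer yes, and an encoding
  of instances as natural numbers. Nothing is required of the algorithm on numbers that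
  encode no instance.\<close>

definition decidable :: "('i \<Rightarrow> nat) \<Rightarrow> 'i set \<Rightarrow> 'i set \<Rightarrow> bool" where
  "decidable code I Y \<longleftrightarrow> (\<exists>f. \<forall>x\<in>I. computes f [code x] (if x \<in> Y then 1 else 0))"

primrec ptype_code :: "ptype \<Rightarrow> nat" where
  "ptype_code Sys = 0"
| "ptype_code Env = 1"
| "ptype_code SysEnv = 2"

primrec fm_code :: "fm \<Rightarrow> nat" where
  "fm_code (Type \<theta> x) = prod_encode (0, prod_encode (ptype_code \<theta>, x))"
| "fm_code (Act a x) = prod_encode (1, prod_encode (a, x))"
| "fm_code (Eq x y) = prod_encode (2, prod_encode (x, y))"
| "fm_code (Sim x y) = prod_encode (3, prod_encode (x, y))"
| "fm_code (Less x y) = prod_encode (4, prod_encode (x, y))"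
| "fm_code (Succ x y) = prod_encode (5, prod_encode (x, y))"
| "fm_code (Neg \<phi>) = prod_encode (6, fm_code \<phi>)"
| "fm_code (Or \<phi> \<psi>) = prod_encode (7, prod_encode (fm_code \<phi>, fm_code \<psi>))"
| "fm_code (Ex x \<phi>) = prod_encode (8, prod_encode (x, fm_code \<phi>))"

section \<open>The synthesis problem\<close>

type_synonym inst = "nat set \<times> nat set \<times> fm"

fun inst_code :: "inst \<Rightarrow> nat" where
  "inst_code (As, Ae, \<phi>) = prod_encode (set_encode As, prod_encode (set_encode Ae, fm_code \<phi>))"

definition synthesis_instances :: "(nat set \<Rightarrow> fm set) \<Rightarrow> inst set" where
  "synthesis_instances F =
     {(As, Ae, \<phi>). finite As \<and> finite Ae \<and> As \<inter> Ae = {} \<and> \<phi> \<in> F (As \<union> Ae) \<and> sentence \<phi>}"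

definition synthesis_yes :: "nat set \<Rightarrow> nat set \<Rightarrow> nat set \<Rightarrow> inst set" where
  "synthesis_yes Ns Ne Nse = {(As, Ae, \<phi>). Win As Ae \<phi> \<inter> (Ns \<times> Ne \<times> Nse) \<noteq> {}}"

definition synthesis_decidable ::
  "(nat set \<Rightarrow> fm set) \<Rightarrow> nat set \<Rightarrow> nat set \<Rightarrow> nat set \<Rightarrow> bool" where
  "synthesis_decidable F Ns Ne Nse \<longleftrightarrow>
     decidable inst_code (synthesis_instances F) (synthesis_yes Ns Ne Nse)"

lemma fm_code_inj: "fm_code \<phi> = fm_code \<psi> \<Longrightarrow> \<phi> = \<psi>"
proof (induction \<phi> arbitrary: \<psi>)
  case (Type \<theta> x)
  have "ptype_code \<theta> = ptype_code \<theta>' \<Longrightarrow> \<theta> = \<theta>'" for \<theta>'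
    by (cases \<theta>; cases \<theta>') auto
  with Type show ?case by (cases \<psi>) auto
next
  case (Or \<phi>1 \<phi>2)
  then show ?case by (cases \<psi>) auto
qed (case_tac \<psi>; force)+

lemma inst_code_inj_on: "inj_on inst_code (synthesis_instances F)"
proof (rule inj_onI)
  fix x y
  assume "x \<in> synthesis_instances F" "y \<in> synthesis_instances F" "inst_code x = inst_code y"
  then show "x = y"
    by (cases x; cases y) (simp add: synthesis_instances_def set_encode_eq fm_code_inj)
qed

end

theory Submission
  imports Defs
begin

text \<open>The halting problem reduces to synthesis as follows. A recursive function is simulated by a
  nondeterministic counter machine, and System plays the transitions of a halting run, one event
  per transition. Counter \<open>c\<close> is represented by the processes on which an increment of \<open>c\<close> but no
  decrement has occurred; every process is incremented and decremented at most once, so that the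
  number of processes bounds the number of increments in the run. Two variables suffice to express
  everything except zero tests. These are delegated to Environment: immediately after a zero test of
  \<open>c\<close> it may point at a process, and System loses if that process still counts towards \<open>c\<close>. Since
  Environment's event lies on the process in question, this condition again needs only two
  variables. Any other move of Environment lets System win.

  No universal machine is needed. The instance with formula \<open>\<phi>\<close> and input \<open>n\<close> is computable from
  \<open>n\<close> and \<open>e\<close>, the code of \<open>\<phi>\<close>; so a decision procedure yields a program that halts on \<open>e\<close> iff the
  instance with \<open>n = e\<close> has answer no. If \<open>\<phi>\<close> is the formula of that very program, this
  instance has answer yes iff the program halts on \<open>e\<close>, a contradiction.\<close>

section \<open>Nondeterministic counter machines\<close>

type_synonym valn = "nat \<Rightarrow> nat"

datatype cop = CInc nat | CDec nat | CZero nat | CNop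

fun op_rel :: "cop \<Rightarrow> (valn \<times> valn) set" where
  "op_rel (CInc c) = {(v, v(c := Suc (v c))) | v. True}"
| "op_rel (CDec c) = {(v, v(c := v c - 1)) | v. 0 < v c}"
| "op_rel (CZero c) = {(v, v) | v. v c = 0}"
| "op_rel CNop = Id"

type_synonym trans = "nat \<times> cop \<times> nat"

definition trans_rel :: "trans set \<Rightarrow> ((nat \<times> valn) \<times> (nat \<times> valn)) set" where
  "trans_rel T = {((q, v), (q', v')) | q v q' v'. \<exists>m. (q, m, q') \<in> T \<and> (v, v') \<in> op_rel m}"

text \<open>Relations between register contents before and after a program are handled like
  languages of finite automata. Closure under composition and iteration then replaces a programming
  language.\<close>

definition recognizable :: "(valn \<times> valn) set \<Rightarrow> bool" where
  "recognizable R \<longleftrightarrow> (\<exists>T q\<^sub>0 q\<^sub>f. finite T \<and>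
     (\<forall>v v'. (v, v') \<in> R \<longleftrightarrow> ((q\<^sub>0, v), (q\<^sub>f, v')) \<in> (trans_rel T)\<^sup>*))"

lemma trans_relI: "(q, m, q') \<in> T \<Longrightarrow> (v, v') \<in> op_rel m \<Longrightarrow> ((q, v), (q', v')) \<in> trans_rel T"
  by (auto simp: trans_rel_def)

lemma trans_rel_rtrancl_embed:
  assumes "((q, v), (q', v')) \<in> (trans_rel T)\<^sup>*"
    and "\<And>q m q'. (q, m, q') \<in> T \<Longrightarrow> (h q, m, h q') \<in> T'"
  shows "((h q, v), (h q', v')) \<in> (trans_rel T')\<^sup>*"
  using assms(1)
proof (induction rule: rtrancl_induct2)
  case refl
  then show ?case by simp
next
  case (step a b c d)
  then have "((h a, b), (h c, d)) \<in> trans_rel T'"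
    using assms(2) by (auto simp: trans_rel_def)
  with step.IH show ?case by (rule rtrancl_into_rtrancl)
qed

lemma recognizable_op: "recognizable (op_rel m)"
proof -
  \<comment> \<open>Start and end must differ, as the empty path would otherwise add the identity
    relation.\<close>
  have "((0, v), (1, v')) \<in> (trans_rel {(0, m, 1)})\<^sup>* \<longleftrightarrow> (v, v') \<in> op_rel m" for v v'
  proof
    have "(q, u) = (0, v) \<or> q = 1 \<and> (v, u) \<in> op_rel m"
      if "((0, v), (q, u)) \<in> (trans_rel {(0, m, 1)})\<^sup>*" for q u
      using that by (induction rule: rtrancl_induct2) (auto simp: trans_rel_def)
    then show "((0, v), (1, v')) \<in> (trans_rel {(0, m, 1)})\<^sup>* \<Longrightarrow> (v, v') \<in> op_rel m"
      by fastforce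
  qed (auto intro: trans_relI)
  then show ?thesis
    unfolding recognizable_def by (intro exI[of _ "{(0, m, 1)}"] exI[of _ 0] exI[of _ 1]) auto
qed

lemma recognizable_empty: "recognizable {}"
proof -
  have "((0, v), (1, v')) \<notin> (trans_rel {})\<^sup>*" for v v'
    by (auto simp: trans_rel_def)
  then show ?thesis
    unfolding recognizable_def by (intro exI[of _ "{}"] exI[of _ 0] exI[of _ 1]) auto
qed

text \<open>The machines run on disjoint copies of their states, even and odd, joined by one idle
  transition. Nothing leads back from odd to even states, so every path from start to end crosses
  this transition exactly once and splits there.\<close>

lemma recognizable_relcomp:
  assumes "recognizable R" "recognizable S"
  shows "recognizable (R O S)"
proof -
  obtain T a b where T: "finite T" "\<And>v v'. (v, v') \<in> R \<longleftrightarrow> ((a, v), (b, v')) \<in> (trans_rel T)\<^sup>*"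
    using assms(1) unfolding recognizable_def by blast
  obtain U c d where U: "finite U" "\<And>v v'. (v, v') \<in> S \<longleftrightarrow> ((c, v), (d, v')) \<in> (trans_rel U)\<^sup>*"
    using assms(2) unfolding recognizable_def by blast
  define W where "W = (\<lambda>(q, m, q'). (2 * q, m, 2 * q')) ` T \<union>
    (\<lambda>(q, m, q'). (2 * q + 1, m, 2 * q' + 1)) ` U \<union> {(2 * b, CNop, 2 * c + 1)}"
  have "finite W" using T(1) U(1) by (simp add: W_def)
  moreover have "(v, v') \<in> R O S \<longleftrightarrow> ((2 * a, v), (2 * d + 1, v')) \<in> (trans_rel W)\<^sup>*" for v v'
  proof
    assume "(v, v') \<in> R O S"
    then obtain u where u: "(v, u) \<in> R" "(u, v') \<in> S" by blast
    have "((2 * a, v), (2 * b, u)) \<in> (trans_rel W)\<^sup>*"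
      using u(1) T(2) by (auto intro!: trans_rel_rtrancl_embed[where h = "\<lambda>q. 2 * q"] simp: W_def image_iff)
    also have "((2 * b, u), (2 * c + 1, u)) \<in> trans_rel W"
      by (rule trans_relI[of _ CNop]) (auto simp: W_def)
    also have "((2 * c + 1, u), (2 * d + 1, v')) \<in> (trans_rel W)\<^sup>*"
      by (rule trans_rel_rtrancl_embed[where h = "\<lambda>q. 2 * q + 1"]) (use u(2) U(2) in \<open>force simp: W_def\<close>)+
    finally show "((2 * a, v), (2 * d + 1, v')) \<in> (trans_rel W)\<^sup>*" .
  next
    \<comment> \<open>Invariant of reachable configurations: the parity of the state tells which of
      the two machines is running.\<close>
    have "(\<exists>q'. q = 2 * q' \<and> ((a, v), (q', u)) \<in> (trans_rel T)\<^sup>*) \<or>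
          (\<exists>q' w. q = 2 * q' + 1 \<and> (v, w) \<in> R \<and> ((c, w), (q', u)) \<in> (trans_rel U)\<^sup>*)"
      if "((2 * a, v), (q, u)) \<in> (trans_rel W)\<^sup>*" for q u
      using that
    proof (induction rule: rtrancl_induct2)
      case refl
      then show ?case by auto
    next
      case (step q w r x)
      from step.hyps(2) obtain m where m: "(q, m, r) \<in> W" "(w, x) \<in> op_rel m"
        by (auto simp: trans_rel_def)
      from m(1) consider
          (T) q' r' where "q = 2 * q'" "r = 2 * r'" "(q', m, r') \<in> T"
        | (U) q' r' where "q = 2 * q' + 1" "r = 2 * r' + 1" "(q', m, r') \<in> U"
        | (X) "q = 2 * b" "m = CNop" "r = 2 * c + 1"
        unfolding W_def by auto
      then show ?case
      proof cases
        case T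
        then have "((a, v), (q', w)) \<in> (trans_rel T)\<^sup>*" using step.IH by auto presburger
        with T m(2) show ?thesis by (blast intro: rtrancl_into_rtrancl trans_relI)
      next
        case U
        then obtain y where "(v, y) \<in> R" "((c, y), (q', w)) \<in> (trans_rel U)\<^sup>*"
          using step.IH by auto presburger
        with U m(2) show ?thesis by (blast intro: rtrancl_into_rtrancl trans_relI)
      next
        case X
        then have "((a, v), (b, w)) \<in> (trans_rel T)\<^sup>*" using step.IH by auto presburger
        with X m(2) show ?thesis using assms T(2) by auto
      qed
    qed
    from this[of "2 * d + 1" v'] show "((2 * a, v), (2 * d + 1, v')) \<in> (trans_rel W)\<^sup>* \<Longrightarrow> (v, v') \<in> R O S"
      using U(2) by auto presburger
  qed
  ultimately show ?thesis unfolding recognizable_def by blast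
qed

text \<open>A fresh state 0, both start and end, is linked by idle transitions to the shifted
  machine. Each return to 0 completes one iteration, even if the old machine passes repeatedly
  through its own start or end.\<close>

lemma recognizable_rtrancl:
  assumes "recognizable R"
  shows "recognizable (R\<^sup>*)"
proof -
  obtain T a b where T: "finite T" "\<And>v v'. (v, v') \<in> R \<longleftrightarrow> ((a, v), (b, v')) \<in> (trans_rel T)\<^sup>*"
    using assms(1) unfolding recognizable_def by blast
  define W where "W = (\<lambda>(q, m, q'). (Suc q, m, Suc q')) ` T \<union> {(0, CNop, Suc a), (Suc b, CNop, 0)}"
  have "finite W" using T(1) by (simp add: W_def)
  moreover have "(v, v') \<in> R\<^sup>* \<longleftrightarrow> ((0, v), (0, v')) \<in> (trans_rel W)\<^sup>*" for v v'
  proof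
    have *: "((0, u), (0, u')) \<in> (trans_rel W)\<^sup>*" if "(u, u') \<in> R" for u u'
    proof -
      have "((0, u), (Suc a, u)) \<in> trans_rel W"
        by (rule trans_relI[of _ CNop]) (auto simp: W_def)
      also have "((Suc a, u), (Suc b, u')) \<in> (trans_rel W)\<^sup>*"
        by (rule trans_rel_rtrancl_embed[where h = Suc]) (use that T(2) in \<open>force simp: W_def\<close>)+
      also have "((Suc b, u'), (0, u')) \<in> trans_rel W"
        by (rule trans_relI[of _ CNop]) (auto simp: W_def)
      finally show ?thesis .
    qed
    show "(v, v') \<in> R\<^sup>* \<Longrightarrow> ((0, v), (0, v')) \<in> (trans_rel W)\<^sup>*"
      by (induction rule: rtrancl_induct) (auto intro: rtrancl_trans *)
  next
    have "(q = 0 \<and> (v, u) \<in> R\<^sup>*) \<or>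
          (\<exists>q' w. q = Suc q' \<and> (v, w) \<in> R\<^sup>* \<and> ((a, w), (q', u)) \<in> (trans_rel T)\<^sup>*)"
      if "((0, v), (q, u)) \<in> (trans_rel W)\<^sup>*" for q u
      using that
    proof (induction rule: rtrancl_induct2)
      case refl
      then show ?case by auto
    next
      case (step q w r x)
      from step.hyps(2) obtain m where m: "(q, m, r) \<in> W" "(w, x) \<in> op_rel m"
        by (auto simp: trans_rel_def)
      from m(1) consider
          (T) q' r' where "q = Suc q'" "r = Suc r'" "(q', m, r') \<in> T"
        | (I) "q = 0" "m = CNop" "r = Suc a"
        | (O) "q = Suc b" "m = CNop" "r = 0"
        unfolding W_def by auto
      then show ?case
      proof cases
        case T
        with step.IH m(2) show ?thesis by (blast intro: rtrancl_into_rtrancl trans_relI)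
      next
        case I
        with step.IH m(2) show ?thesis by auto
      next
        case O
        with step.IH obtain y where "(v, y) \<in> R\<^sup>*" "(y, w) \<in> R" using T(2) by auto
        with O m(2) show ?thesis by auto
      qed
    qed
    from this[of 0 v'] show "((0, v), (0, v')) \<in> (trans_rel W)\<^sup>* \<Longrightarrow> (v, v') \<in> R\<^sup>*"
      by auto
  qed
  ultimately show ?thesis unfolding recognizable_def by blast
qed

section \<open>Compiling recursive functions\<close>

definition clear_rel :: "nat \<Rightarrow> (valn \<times> valn) set" where
  "clear_rel c = {(v, v(c := 0)) | v. True}"

definition copy_rel :: "nat \<Rightarrow> nat \<Rightarrow> nat \<Rightarrow> (valn \<times> valn) set" where
  "copy_rel x y s = {(v, v(s := 0, y := v x)) | v. True}"

text \<open>The decrement loop may be left at any time, but the zero test behind it discards all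
  paths that leave too early.\<close>

lemma recognizable_clear: "recognizable (clear_rel c)"
proof -
  have "clear_rel c = (op_rel (CDec c))\<^sup>* O op_rel (CZero c)"
  proof (intro set_eqI iffI; clarify)
    fix v v' assume "(v, v') \<in> clear_rel c"
    then have v': "v' = v(c := 0)" by (auto simp: clear_rel_def)
    have "(v, v(c := 0)) \<in> (op_rel (CDec c))\<^sup>*" for v
    proof (induction "v c" arbitrary: v)
      case 0
      then have "v(c := 0) = v" by auto
      then show ?case by simp
    next
      case (Suc n)
      have "(v, v(c := n)) \<in> op_rel (CDec c)" using Suc.hyps(2)[symmetric] by (auto intro!: exI[of _ v])
      also have "(v(c := n), v(c := 0)) \<in> (op_rel (CDec c))\<^sup>*" using Suc.hyps(1)[of "v(c := n)"] by simp
      finally show ?case .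
    qed
    moreover have "(v(c := 0), v(c := 0)) \<in> op_rel (CZero c)" by auto
    ultimately show "(v, v') \<in> (op_rel (CDec c))\<^sup>* O op_rel (CZero c)"
      unfolding v' by (rule relcompI)
  next
    fix v u v' assume "(v, u) \<in> (op_rel (CDec c))\<^sup>*" and z: "(u, v') \<in> op_rel (CZero c)"
    from this(1) have "\<forall>r. r \<noteq> c \<longrightarrow> u r = v r"
      by (induction rule: rtrancl_induct) auto
    with z have "v' = v(c := 0)" by (auto simp: fun_eq_iff)
    then show "(v, v') \<in> clear_rel c" by (auto simp: clear_rel_def)
  qed
  then show ?thesis
    by (simp only:) (intro recognizable_relcomp recognizable_rtrancl recognizable_op)
qed

text \<open>One loop drains \<open>x\<close> into both \<open>y\<close> and \<open>s\<close>, a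
  second one moves \<open>s\<close> back into \<open>x\<close>; the zero tests force both loops to
  run to their end.\<close>

lemma recognizable_copy:
  assumes "x \<noteq> y" "x \<noteq> s" "y \<noteq> s"
  shows "recognizable (copy_rel x y s)"
proof -
  define B where "B = op_rel (CDec x) O op_rel (CInc y) O op_rel (CInc s)"
  define C where "C = op_rel (CDec s) O op_rel (CInc x)"
  have Bstep: "(v, v') \<in> B \<longleftrightarrow> 0 < v x \<and> v' = v(x := v x - 1, y := Suc (v y), s := Suc (v s))" for v v'
    using assms by (auto simp: B_def relcomp_unfold)
  have Cstep: "(v, v') \<in> C \<longleftrightarrow> 0 < v s \<and> v' = v(s := v s - 1, x := Suc (v x))" for v v'
    using assms by (auto simp: C_def relcomp_unfold)
  have B: "(v, v(x := 0, y := v y + v x, s := v s + v x)) \<in> B\<^sup>*" for v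
  proof (induction "v x" arbitrary: v)
    case 0
    then have "v(x := 0, y := v y + v x, s := v s + v x) = v" by auto
    then show ?case by (simp only: rtrancl.rtrancl_refl)
  next
    case (Suc n)
    let ?u = "v(x := n, y := Suc (v y), s := Suc (v s))"
    have "(v, ?u) \<in> B" using Suc.hyps(2)[symmetric] by (auto simp: Bstep)
    also have "(?u, ?u(x := 0, y := ?u y + ?u x, s := ?u s + ?u x)) \<in> B\<^sup>*"
      using Suc.hyps(1)[of ?u] assms by simp
    also have "?u(x := 0, y := ?u y + ?u x, s := ?u s + ?u x) = v(x := 0, y := v y + v x, s := v s + v x)"
      using assms Suc.hyps(2) by (auto simp: fun_eq_iff)
    finally show ?case .
  qed
  have C: "(v, v(s := 0, x := v x + v s)) \<in> C\<^sup>*" for v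
  proof (induction "v s" arbitrary: v)
    case 0
    then have "v(s := 0, x := v x + v s) = v" by auto
    then show ?case by (simp only: rtrancl.rtrancl_refl)
  next
    case (Suc n)
    let ?u = "v(s := n, x := Suc (v x))"
    have "(v, ?u) \<in> C" using Suc.hyps(2)[symmetric] by (auto simp: Cstep)
    also have "(?u, ?u(s := 0, x := ?u x + ?u s)) \<in> C\<^sup>*"
      using Suc.hyps(1)[of ?u] assms by simp
    also have "?u(s := 0, x := ?u x + ?u s) = v(s := 0, x := v x + v s)"
      using assms Suc.hyps(2) by (auto simp: fun_eq_iff)
    finally show ?case .
  qed
  \<comment> \<open>Sums preserved by the loops. Together with the zero tests they determine the
    result without counting rounds.\<close>
  have B': "u x + u y = v x + v y \<and> u x + u s = v x + v s \<and> (\<forall>r. r \<notin> {x, y, s} \<longrightarrow> u r = v r)"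
    if "(v, u) \<in> B\<^sup>*" for v u
    using that by (induction rule: rtrancl_induct) (use assms in \<open>auto simp: Bstep\<close>)
  have C': "u x + u s = v x + v s \<and> (\<forall>r. r \<notin> {x, s} \<longrightarrow> u r = v r)"
    if "(v, u) \<in> C\<^sup>*" for v u
    using that by (induction rule: rtrancl_induct) (use assms in \<open>auto simp: Cstep\<close>)
  have "copy_rel x y s = clear_rel y O clear_rel s O B\<^sup>* O op_rel (CZero x) O C\<^sup>* O op_rel (CZero s)"
  proof (intro set_eqI iffI; clarify)
    fix v v' assume "(v, v') \<in> copy_rel x y s"
    then have v': "v' = v(s := 0, y := v x)" by (auto simp: copy_rel_def)
    let ?w = "v(y := 0, s := 0)"
    let ?u = "v(x := 0, y := v x, s := v x)"
    have 1: "(v, v(y := 0)) \<in> clear_rel y" "(v(y := 0), ?w) \<in> clear_rel s"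
      by (auto simp: clear_rel_def)
    have 2: "(?w, ?u) \<in> B\<^sup>*"
      using B[of ?w] assms by (simp add: fun_upd_twist)
    have 3: "(?u, ?u) \<in> op_rel (CZero x)" using assms by auto
    have 4: "(?u, v') \<in> C\<^sup>*"
    proof -
      have "?u(s := 0, x := ?u x + ?u s) = v'" using assms by (auto simp: v' fun_eq_iff)
      then show ?thesis using C[of ?u] by simp
    qed
    have 5: "(v', v') \<in> op_rel (CZero s)" using assms by (auto simp: v')
    show "(v, v') \<in> clear_rel y O clear_rel s O B\<^sup>* O op_rel (CZero x) O C\<^sup>* O op_rel (CZero s)"
      by (intro relcompI) (rule 1 2 3 4 5)+
  next
    fix v a b c d e v'
    assume a: "(v, a) \<in> clear_rel y" "(a, b) \<in> clear_rel s" "(b, c) \<in> B\<^sup>*" "(c, d) \<in> op_rel (CZero x)"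
      "(d, e) \<in> C\<^sup>*" "(e, v') \<in> op_rel (CZero s)"
    have b: "b = v(y := 0, s := 0)" using a(1,2) by (auto simp: clear_rel_def)
    have z: "d = c" "c x = 0" "v' = e" "e s = 0" using a(4,6) by auto
    have c: "c y = v x" "c s = v x" "r \<notin> {x, y, s} \<Longrightarrow> c r = v r" for r
      using B'[OF a(3)] assms by (auto simp: b z)
    have "v' x = v x" "v' s = 0" "r \<notin> {x, s} \<Longrightarrow> v' r = c r" for r
      using C'[OF a(5)] assms c(2) by (auto simp: z)
    with c have "v' r = (v(s := 0, y := v x)) r" for r
      using assms by (cases "r = x") auto
    then show "(v, v') \<in> copy_rel x y s" by (auto simp: copy_rel_def fun_eq_iff)
  qed
  then show ?thesis
    by (simp only: B_def C_def)
      (intro recognizable_relcomp recognizable_rtrancl recognizable_op recognizable_clear)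
qed

text \<open>Registers from \<open>b\<close> onwards are scratch space with arbitrary contents before and after.\<close>

definition computes_into ::
  "(valn \<times> valn) set \<Rightarrow> recf \<Rightarrow> nat list \<Rightarrow> nat \<Rightarrow> nat \<Rightarrow> bool" where
  "computes_into R g args out b \<longleftrightarrow>
     (\<forall>v v'. (v, v') \<in> R \<longrightarrow> computes g (map v args) (v' out) \<and> (\<forall>r<b. r \<noteq> out \<longrightarrow> v' r = v r)) \<and>
     (\<forall>v z. computes g (map v args) z \<longrightarrow> (\<exists>v'. (v, v') \<in> R))"

definition compilable :: "recf \<Rightarrow> bool" where
  "compilable g \<longleftrightarrow> (\<forall>args out b. set args \<subseteq> {..<b} \<longrightarrow> out < b \<longrightarrow> out \<notin> set args \<longrightarrow>
     (\<exists>R. recognizable R \<and> computes_into R g args out b))"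

lemma computes_intoD:
  assumes "computes_into R g args out b" "(v, v') \<in> R"
  shows "computes g (map v args) (v' out)" "r < b \<Longrightarrow> r \<noteq> out \<Longrightarrow> v' r = v r"
  using assms unfolding computes_into_def by blast+

text \<open>\<open>computes_into\<close> promises some run with some correct value; determinism of
  \<open>computes\<close> identifies this value with \<open>z\<close>.\<close>

lemma computes_intoE:
  assumes "computes_into R g args out b" "computes g (map v args) z"
  obtains v' where "(v, v') \<in> R" "v' out = z"
  using assms computes_deterministic unfolding computes_into_def by blast

lemma compilableE:
  assumes "compilable g" "set args \<subseteq> {..<b}" "out < b" "out \<notin> set args"
  obtains R where "recognizable R" "computes_into R g args out b"
  using assms unfolding compilable_def by blast

text \<open>Covers applications to a wrong number of arguments: the function is undefined there, so
  the machine must have no complete run.\<close>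

lemma computes_into_empty:
  assumes "\<And>xs z. length xs = length args \<Longrightarrow> \<not> computes g xs z"
  shows "computes_into {} g args out b"
  using assms by (auto simp: computes_into_def)

section \<open>Machines for the constructors of recursive functions\<close>

lemma compilable_RZero: "compilable RZero"
  unfolding compilable_def
proof (intro allI impI)
  fix args :: "nat list" and out b :: nat
  show "\<exists>R. recognizable R \<and> computes_into R RZero args out b"
    by (intro exI[of _ "clear_rel out"] conjI recognizable_clear)
      (auto simp: computes_into_def clear_rel_def intro: computes.intros)
qed

lemma compilable_RProj: "compilable (RProj i)"
  unfolding compilable_def
proof (intro allI impI)
  fix args :: "nat list" and out b :: nat
  assume a: "set args \<subseteq> {..<b}" "out < b" "out \<notin> set args"
  show "\<exists>R. recognizable R \<and> computes_into R (RProj i) args out b"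
  proof (cases "i < length args")
    case True
    then have m: "args ! i \<in> set args" by simp
    show ?thesis
    proof (intro exI[of _ "copy_rel (args ! i) out b"] conjI recognizable_copy)
      show "computes_into (copy_rel (args ! i) out b) (RProj i) args out b"
        using computes.proj[of i "map v args" for v] True
        by (auto simp: computes_into_def copy_rel_def)
    qed (use a m in auto)
  next
    case False
    then have "computes_into {} (RProj i) args out b"
      by (intro computes_into_empty) (auto elim: computes_RProjE)
    then show ?thesis using recognizable_empty by blast
  qed
qed

lemma compilable_RSucc: "compilable RSucc"
  unfolding compilable_def
proof (intro allI impI)
  fix args :: "nat list" and out b :: nat
  assume a: "set args \<subseteq> {..<b}" "out < b" "out \<notin> set args"
  show "\<exists>R. recognizable R \<and> computes_into R RSucc args out b"
  proof (cases "length args = 1")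
    case True
    then obtain x where x: "args = [x]" by (cases args) auto
    show ?thesis
    proof (intro exI[of _ "copy_rel x out b O op_rel (CInc out)"] conjI
        recognizable_relcomp recognizable_copy recognizable_op)
      show "computes_into (copy_rel x out b O op_rel (CInc out)) RSucc args out b"
        using computes.succ by (auto simp: computes_into_def copy_rel_def x)
    qed (use a x in auto)
  next
    case False
    then have "computes_into {} RSucc args out b"
      by (intro computes_into_empty) (auto elim: computes_RSuccE)
    then show ?thesis using recognizable_empty by blast
  qed
qed

definition computes_list_into ::
  "(valn \<times> valn) set \<Rightarrow> recf list \<Rightarrow> nat list \<Rightarrow> nat \<Rightarrow> bool" where
  "computes_list_into R gs args c \<longleftrightarrow>
     (\<forall>v v'. (v, v') \<in> R \<longrightarrow>
        list_all2 (\<lambda>g y. computes g (map v args) y) gs (map v' [c..<c + length gs]) \<and>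
        (\<forall>r<c. v' r = v r)) \<and>
     (\<forall>v ys. list_all2 (\<lambda>g y. computes g (map v args) y) gs ys \<longrightarrow> (\<exists>v'. (v, v') \<in> R))"

lemma computes_list_intoD:
  assumes "computes_list_into R gs args c"
  shows "(v, v') \<in> R \<Longrightarrow>
      list_all2 (\<lambda>g y. computes g (map v args) y) gs (map v' [c..<c + length gs])"
    and "(v, v') \<in> R \<Longrightarrow> r < c \<Longrightarrow> v' r = v r"
    and "list_all2 (\<lambda>g y. computes g (map v args) y) gs ys \<Longrightarrow> \<exists>v'. (v, v') \<in> R"
  using assms unfolding computes_list_into_def by blast+

text \<open>Results go to consecutive registers from \<open>c\<close> on. All programs share the
  scratch space starting at \<open>b\<close>, beyond these registers, so a later program spoils
  neither the arguments nor the earlier results.\<close>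

lemma compilable_list:
  assumes "\<forall>g\<in>set gs. compilable g" "set args \<subseteq> {..<c}" "c + length gs \<le> b"
  shows "\<exists>R. recognizable R \<and> computes_list_into R gs args c"
  using assms
proof (induction gs arbitrary: c)
  case Nil
  show ?case
    by (intro exI[of _ "op_rel CNop"] conjI recognizable_op) (auto simp: computes_list_into_def)
next
  case (Cons g gs)
  from Cons.prems have "compilable g" by simp
  then obtain R where R: "recognizable R" "computes_into R g args c b"
    by (rule compilableE[of _ args b c]) (use Cons.prems in auto)
  have "\<exists>R. recognizable R \<and> computes_list_into R gs args (Suc c)"
    by (rule Cons.IH) (use Cons.prems in auto)
  then obtain S' where S': "recognizable S'" "computes_list_into S' gs args (Suc c)" by blast
  note S = S'(1) computes_list_intoD[OF S'(2)]
  have upt: "[c..<c + length (g # gs)] = c # [Suc c..<Suc c + length gs]"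
    by (subst upt_conv_Cons) auto
  have args: "map u args = map v args" if "(v, u) \<in> R" for u v
    using computes_intoD(2)[OF R(2) that] Cons.prems(2,3) by (auto intro!: map_cong)
  show ?case
  proof (intro exI[of _ "R O S'"] conjI recognizable_relcomp R(1) S(1),
      unfold computes_list_into_def, intro conjI allI impI)
    fix v v' assume "(v, v') \<in> R O S'"
    then obtain u where u: "(v, u) \<in> R" "(u, v') \<in> S'" by blast
    have "computes g (map v args) (v' c)"
      using computes_intoD(1)[OF R(2) u(1)] S(3)[OF u(2), of c] by simp
    then show "list_all2 (\<lambda>g y. computes g (map v args) y) (g # gs) (map v' [c..<c + length (g # gs)])"
      using S(2)[OF u(2)] args[OF u(1)] unfolding upt by simp
    fix r assume "r < c"
    then show "v' r = v r"
      using computes_intoD(2)[OF R(2) u(1), of r] S(3)[OF u(2), of r] Cons.prems by simp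
  next
    fix v ys assume "list_all2 (\<lambda>g y. computes g (map v args) y) (g # gs) ys"
    then obtain y ys' where y: "computes g (map v args) y"
      "list_all2 (\<lambda>g y. computes g (map v args) y) gs ys'" by (auto simp: list_all2_Cons1)
    from R(2) y(1) obtain u where u: "(v, u) \<in> R" by (rule computes_intoE)
    from y(2) obtain v' where "(u, v') \<in> S'" using S(4)[of u ys'] args[OF u] by auto
    with u show "\<exists>v'. (v, v') \<in> R O S'" by blast
  qed
qed

lemma compilable_RComp:
  assumes "compilable f" "\<forall>g\<in>set gs. compilable g"
  shows "compilable (RComp f gs)"
  unfolding compilable_def
proof (intro allI impI)
  fix args :: "nat list" and out b :: nat
  assume a: "set args \<subseteq> {..<b}" "out < b" "out \<notin> set args"
  let ?b = "b + length gs"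
  obtain R where "recognizable R" and R': "computes_list_into R gs args b"
    using compilable_list[OF assms(2) a(1) order_refl] by blast
  note R = \<open>recognizable R\<close> computes_list_intoD[OF R']
  \<comment> \<open>The intermediate results occupy the registers from \<open>b\<close> up to
    \<open>?b\<close>, so the scratch space of \<open>f\<close> has to begin at
    \<open>?b\<close>.\<close>
  obtain S where S: "recognizable S" "computes_into S f [b..<?b] out ?b"
    using assms(1) by (rule compilableE[of _ "[b..<?b]" ?b out]) (use a in auto)
  show "\<exists>R. recognizable R \<and> computes_into R (RComp f gs) args out b"
  proof (intro exI[of _ "R O S"] conjI recognizable_relcomp R(1) S(1))
    show "computes_into (R O S) (RComp f gs) args out b"
      unfolding computes_into_def
    proof (intro conjI allI impI)
      fix v v' assume "(v, v') \<in> R O S"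
      then obtain u where u: "(v, u) \<in> R" "(u, v') \<in> S" by blast
      show "computes (RComp f gs) (map v args) (v' out)"
        using R(2)[OF u(1)] computes_intoD(1)[OF S(2) u(2)] by (rule computes.comp)
      fix r assume "r < b" "r \<noteq> out"
      then show "v' r = v r"
        using R(3)[OF u(1)] computes_intoD(2)[OF S(2) u(2)] by simp
    next
      fix v z assume "computes (RComp f gs) (map v args) z"
      then obtain ys where ys: "list_all2 (\<lambda>g y. computes g (map v args) y) gs ys" "computes f ys z"
        by (rule computes_RCompE)
      then obtain u where u: "(v, u) \<in> R" using R(4) by blast
      have "ys = map u [b..<?b]"
      proof (rule nth_equalityI)
        show "length ys = length (map u [b..<?b])" using list_all2_lengthD[OF ys(1)] by simp
        fix i assume "i < length ys"
        then show "ys ! i = map u [b..<?b] ! i"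
          using list_all2_nthD2[OF ys(1)] list_all2_nthD2[OF R(2)[OF u], of i]
            list_all2_lengthD[OF ys(1)]
          by (auto intro: computes_deterministic)
      qed
      with ys(2) have "computes f (map u [b..<?b]) z" by simp
      with S(2) obtain v' where "(u, v') \<in> S" by (rule computes_intoE)
      with u show "\<exists>v'. (v, v') \<in> R O S" by blast
    qed
  qed
qed

text \<open>Register \<open>?n\<close> holds the candidate and \<open>?t\<close> the value of
  \<open>f\<close> there. Each round of the search starts by decrementing \<open>?t\<close>, which
  is possible exactly if the value is positive, as minimisation demands of all smaller candidates.
  The final zero test accepts the candidate.\<close>

lemma compilable_RMin:
  assumes "compilable f"
  shows "compilable (RMin f)"
  unfolding compilable_def
proof (intro allI impI)
  fix args :: "nat list" and out b :: nat
  assume a: "set args \<subseteq> {..<b}" "out < b" "out \<notin> set args"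
  let ?n = b and ?t = "b + 1"
  obtain F where F: "recognizable F" "computes_into F f (?n # args) ?t (b + 2)"
    using assms(1) by (rule compilableE[of _ "?n # args" "b + 2" ?t]) (use a in auto)
  define B where "B = op_rel (CDec ?t) O op_rel (CInc ?n) O F"
  let ?R = "clear_rel ?n O F O B\<^sup>* O op_rel (CZero ?t) O copy_rel ?n out ?t"
  have Fargs: "map u (?n # args) = map v (?n # args)" if "(v, u) \<in> F" for v u
    using computes_intoD(2)[OF F(2) that] a(1) by (intro map_cong) auto
  have F1: "computes f (u ?n # map u args) (u ?t)" "u ?n = v ?n" "\<forall>r<b. u r = v r" if "(v, u) \<in> F" for v u
    using computes_intoD[OF F(2) that] Fargs[OF that] by (simp_all del: map_eq_conv)
  have Bstep: "\<exists>w. (w, v') \<in> F \<and> w = v(?t := v ?t - 1, ?n := Suc (v ?n)) \<and> 0 < v ?t" if "(v, v') \<in> B" for v v'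
    using that unfolding B_def by auto
  have argsb: "map u args = map v args" if "\<forall>r<b. u r = v r" for u v
    using that a(1) by (auto intro!: map_cong)
  show "\<exists>R. recognizable R \<and> computes_into R (RMin f) args out b"
  proof (intro exI[of _ ?R] conjI)
    show "recognizable ?R"
      unfolding B_def
      by (intro recognizable_relcomp recognizable_rtrancl recognizable_op recognizable_clear
          recognizable_copy F(1)) (use a in auto)
    show "computes_into ?R (RMin f) args out b"
      unfolding computes_into_def
    proof (intro conjI allI impI)
      fix v v' assume "(v, v') \<in> ?R"
      then obtain v1 v2 v3 where vs: "(v, v1) \<in> clear_rel ?n" "(v1, v2) \<in> F" "(v2, v3) \<in> B\<^sup>*"
        "(v3, v3) \<in> op_rel (CZero ?t)" "(v3, v') \<in> copy_rel ?n out ?t" by auto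
      have "(\<forall>r<b. v3 r = v r) \<and> computes f (v3 ?n # map v args) (v3 ?t) \<and>
        (\<forall>m<v3 ?n. \<exists>k. computes f (m # map v args) (Suc k))"
        using vs(3)
      proof (induction rule: rtrancl_induct)
        case base
        have "v1 = v(?n := 0)" using vs(1) by (auto simp: clear_rel_def)
        then have "\<forall>r<b. v2 r = v r" "v2 ?n = 0" using F1[OF vs(2)] by auto
        then show ?case using F1(1)[OF vs(2)] argsb[of v2 v] by (simp del: map_eq_conv)
      next
        case (step u w)
        from Bstep[OF step.hyps(2)] obtain x where x: "(x, w) \<in> F"
          "x = u(?t := u ?t - 1, ?n := Suc (u ?n))" "0 < u ?t" by blast
        have eq: "\<forall>r<b. w r = v r" using F1(3)[OF x(1)] x(2) step.IH by simp
        have n: "w ?n = Suc (u ?n)" using F1(2)[OF x(1)] x(2) by simp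
        have "\<exists>k. computes f (u ?n # map v args) (Suc k)"
          using step.IH x(3) by (metis gr0_conv_Suc)
        then have "\<forall>m<w ?n. \<exists>k. computes f (m # map v args) (Suc k)"
          using step.IH n by (auto simp: less_Suc_eq)
        then show ?case using eq F1(1)[OF x(1)] argsb[OF eq] by (simp del: map_eq_conv)
      qed
      moreover have "v3 ?t = 0" "v' = v3(?t := 0, out := v3 ?n)"
        using vs(4,5) by (auto simp: copy_rel_def)
      ultimately show "computes (RMin f) (map v args) (v' out)"
        and "\<And>r. r < b \<Longrightarrow> r \<noteq> out \<Longrightarrow> v' r = v r"
        by (auto intro: computes.min)
    next
      fix v z assume "computes (RMin f) (map v args) z"
      then have z: "computes f (z # map v args) 0"
        "\<And>m. m < z \<Longrightarrow> \<exists>k. computes f (m # map v args) (Suc k)"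
        by (auto elim: computes_RMinE)
      then have tot: "\<exists>k. computes f (m # map v args) k" if "m \<le> z" for m
        using that by (cases "m = z") (auto, meson le_neq_implies_less)
      let ?v1 = "v(?n := 0)"
      have "\<exists>k. computes f (map ?v1 (?n # args)) k"
        using tot[of 0] argsb[of ?v1 v] by (simp del: map_eq_conv)
      then obtain v2 where v2: "(?v1, v2) \<in> F" using F(2) by (blast elim: computes_intoE)
      have "\<exists>u. (v2, u) \<in> B\<^sup>* \<and> u ?n = m \<and> (\<forall>r<b. u r = v r) \<and> computes f (m # map v args) (u ?t)" if "m \<le> z" for m
        using that
      proof (induction m)
        case 0
        have "v2 ?n = 0" "\<forall>r<b. v2 r = v r" using F1[OF v2] by auto
        then show ?case using F1(1)[OF v2] argsb[of v2 v] by (intro exI[of _ v2]) (simp del: map_eq_conv)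
      next
        case (Suc m)
        then obtain u where u: "(v2, u) \<in> B\<^sup>*" "u ?n = m" "\<forall>r<b. u r = v r"
          "computes f (m # map v args) (u ?t)" by auto
        have "0 < u ?t" using z(2)[of m] Suc.prems u(4) computes_deterministic by fastforce
        let ?x = "u(?t := u ?t - 1, ?n := Suc (u ?n))"
        have "\<exists>k. computes f (map ?x (?n # args)) k"
          using tot[of "Suc m"] argsb[of ?x v] u Suc.prems by (simp del: map_eq_conv)
        then obtain w where w: "(?x, w) \<in> F" using F(2) by (blast elim: computes_intoE)
        have "(u, u(?t := u ?t - 1)) \<in> op_rel (CDec ?t)" using \<open>0 < u ?t\<close> by auto
        moreover have "(u(?t := u ?t - 1), ?x) \<in> op_rel (CInc ?n)" by (auto intro!: exI[of _ "u(?t := u ?t - 1)"])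
        ultimately have "(u, w) \<in> B" unfolding B_def using w by blast
        moreover have "w ?n = Suc m" "\<forall>r<b. w r = v r" using F1[OF w] u by auto
        ultimately show ?case using u(1) F1(1)[OF w] argsb[of w v]
          by (intro exI[of _ w]) (auto intro: rtrancl_into_rtrancl simp del: map_eq_conv)
      qed
      from this[of z] obtain u where u: "(v2, u) \<in> B\<^sup>*" "u ?n = z" "computes f (z # map v args) (u ?t)"
        by blast
      have "u ?t = 0" using u(3) z(1) by (rule computes_deterministic)
      then have "(u, u) \<in> op_rel (CZero ?t)" by simp
      moreover have "(v, ?v1) \<in> clear_rel ?n" by (auto simp: clear_rel_def)
      moreover have "(u, u(?t := 0, out := u ?n)) \<in> copy_rel ?n out ?t" by (auto simp: copy_rel_def)
      ultimately show "\<exists>v'. (v, v') \<in> ?R" using v2 u(1) by blast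
    qed
  qed
qed

text \<open>Register \<open>?i\<close> counts the rounds done, \<open>?c\<close> those to come, and
  \<open>?y\<close> holds the current value. The step function writes to \<open>?t\<close> first,
  since a compiled program needs an output register distinct from its arguments.\<close>

lemma compilable_RPrec:
  assumes "compilable f" "compilable g"
  shows "compilable (RPrec f g)"
  unfolding compilable_def
proof (intro allI impI)
  fix args :: "nat list" and out b :: nat
  assume a: "set args \<subseteq> {..<b}" "out < b" "out \<notin> set args"
  show "\<exists>R. recognizable R \<and> computes_into R (RPrec f g) args out b"
  proof (cases args)
    case Nil
    have "\<not> computes (RPrec f g) [] z" for z by (auto elim: computes.cases)
    then have "computes_into {} (RPrec f g) args out b"
      by (intro computes_into_empty) (auto simp: Nil)
    then show ?thesis using recognizable_empty by blast
  next
    case (Cons n as)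
    let ?i = b and ?y = "b + 1" and ?t = "b + 2" and ?c = "b + 3"
    obtain F where F: "recognizable F" "computes_into F f as ?y (b + 4)"
      using assms(1) by (rule compilableE[of _ as "b + 4" ?y]) (use a Cons in auto)
    obtain G where G: "recognizable G" "computes_into G g (?i # ?y # as) ?t (b + 4)"
      using assms(2) by (rule compilableE[of _ "?i # ?y # as" "b + 4" ?t]) (use a Cons in auto)
    define B where "B = op_rel (CDec ?c) O G O copy_rel ?t ?y (b + 4) O op_rel (CInc ?i)"
    let ?R = "clear_rel ?i O copy_rel n ?c ?t O F O B\<^sup>* O op_rel (CZero ?c) O copy_rel ?y out ?t"
    have asb: "map u as = map v as" if "\<forall>r<b. u r = v r" for u v
      using that a(1) Cons by (auto intro!: map_cong)
    have Bstep: "0 < u ?c \<and> w ?c = u ?c - 1 \<and> w ?i = Suc (u ?i) \<and> (\<forall>r<b. w r = u r) \<and>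
        computes g (u ?i # u ?y # map u as) (w ?y)" if "(u, w) \<in> B" for u w
    proof -
      from that obtain x1 x2 x3 where x: "(u, x1) \<in> op_rel (CDec ?c)" "(x1, x2) \<in> G"
        "(x2, x3) \<in> copy_rel ?t ?y (b + 4)" "(x3, w) \<in> op_rel (CInc ?i)" unfolding B_def by blast
      have x1: "x1 = u(?c := u ?c - 1)" "0 < u ?c" using x(1) by auto
      have w: "w = x2(b + 4 := 0, ?y := x2 ?t, ?i := Suc (x2 ?i))"
        using x(3,4) by (auto simp: copy_rel_def)
      have "\<forall>r<b+4. r \<noteq> ?t \<longrightarrow> x2 r = x1 r" using computes_intoD(2)[OF G(2) x(2)] by blast
      moreover have "computes g (map x1 (?i # ?y # as)) (x2 ?t)" using computes_intoD(1)[OF G(2) x(2)] .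
      moreover have "map x1 as = map u as" by (rule asb) (simp add: x1)
      ultimately show ?thesis using x1 w by (simp del: map_eq_conv)
    qed
    have Bex: "\<exists>w. (u, w) \<in> B" if "0 < u ?c" "computes g (u ?i # u ?y # map u as) y" for u y
    proof -
      let ?x = "u(?c := u ?c - 1)"
      have "map ?x as = map u as" by (rule asb) simp
      with that(2) have "computes g (map ?x (?i # ?y # as)) y" by (simp del: map_eq_conv)
      with G(2) obtain x2 where x2: "(?x, x2) \<in> G" by (rule computes_intoE)
      let ?x3 = "x2(b + 4 := 0, ?y := x2 ?t)"
      have "(u, ?x) \<in> op_rel (CDec ?c)" using that(1) by auto
      moreover have "(x2, ?x3) \<in> copy_rel ?t ?y (b + 4)" by (auto simp: copy_rel_def)
      moreover have "(?x3, ?x3(?i := Suc (?x3 ?i))) \<in> op_rel (CInc ?i)"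
        unfolding op_rel.simps by blast
      ultimately show ?thesis unfolding B_def using x2 by blast
    qed
    let ?h = "RPrec f g"
    have nb: "n < b" using a Cons by simp
    show ?thesis
    proof (intro exI[of _ ?R] conjI)
      show "recognizable ?R"
        unfolding B_def
        by (intro recognizable_relcomp recognizable_rtrancl recognizable_op recognizable_clear
            recognizable_copy F(1) G(1)) (use a Cons in auto)
      show "computes_into ?R ?h args out b"
        unfolding computes_into_def
      proof (intro conjI allI impI)
        fix v v' assume "(v, v') \<in> ?R"
        then obtain v1 v2 v3 v4 where vs: "(v, v1) \<in> clear_rel ?i" "(v1, v2) \<in> copy_rel n ?c ?t"
          "(v2, v3) \<in> F" "(v3, v4) \<in> B\<^sup>*"
          "(v4, v4) \<in> op_rel (CZero ?c)" "(v4, v') \<in> copy_rel ?y out ?t" by auto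
        have v2: "v2 = v(?i := 0, ?t := 0, ?c := v n)"
          using vs(1,2) nb by (auto simp: clear_rel_def copy_rel_def)
        have "(\<forall>r<b. v4 r = v r) \<and> v4 ?i + v4 ?c = v n \<and> computes ?h (v4 ?i # map v as) (v4 ?y)"
          using vs(4)
        proof (induction rule: rtrancl_induct)
          case base
          have "\<forall>r<b+4. r \<noteq> ?y \<longrightarrow> v3 r = v2 r" using computes_intoD(2)[OF F(2) vs(3)] by blast
          moreover have "computes f (map v2 as) (v3 ?y)" using computes_intoD(1)[OF F(2) vs(3)] .
          moreover have "map v2 as = map v as" by (rule asb) (simp add: v2)
          ultimately show ?case by (auto simp: v2 intro: computes.prec_0 simp del: map_eq_conv)
        next
          case (step u w)
          have "map u as = map v as" by (rule asb) (use step.IH in simp)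
          then show ?case using Bstep[OF step.hyps(2)] step.IH
            by (auto intro: computes.prec_Suc simp del: map_eq_conv)
        qed
        moreover have "v4 ?c = 0" "v' = v4(?t := 0, out := v4 ?y)"
          using vs(5,6) by (auto simp: copy_rel_def)
        ultimately show "computes ?h (map v args) (v' out)"
          and "\<And>r. r < b \<Longrightarrow> r \<noteq> out \<Longrightarrow> v' r = v r"
          using a by (auto simp: Cons)
      next
        fix v z assume z: "computes ?h (map v args) z"
        \<comment> \<open>Definedness passes downwards from \<open>v n\<close>, because a value of a
          primitive recursion is only obtained from the preceding value.\<close>
        have tot: "\<exists>y. computes ?h ((v n - k) # map v as) y" if "k \<le> v n" for k
          using that
        proof (induction k)
          case 0
          then show ?case using z Cons by auto
        next
          case (Suc k)
          then obtain y where "computes ?h ((v n - k) # map v as) y" by auto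
          moreover have "v n - k = Suc (v n - Suc k)" using Suc.prems by simp
          ultimately have "computes ?h (Suc (v n - Suc k) # map v as) y" by simp
          then show ?case by (rule computes_RPrec_SucE) blast
        qed
        let ?v2 = "v(?i := 0, ?t := 0, ?c := v n)"
        have v12: "(v, v(?i := 0)) \<in> clear_rel ?i" "(v(?i := 0), ?v2) \<in> copy_rel n ?c ?t"
          using nb by (auto simp: clear_rel_def copy_rel_def)
        have v2as: "map ?v2 as = map v as" by (rule asb) simp
        from tot[of "v n"] obtain y0 where "computes ?h (0 # map v as) y0" by auto
        then have y0: "computes f (map ?v2 as) y0" unfolding v2as by (rule computes_RPrec_0E)
        with F(2) obtain v3 where v3: "(?v2, v3) \<in> F" "v3 ?y = y0" by (rule computes_intoE)
        have "\<exists>u. (v3, u) \<in> B\<^sup>* \<and> u ?i = k \<and> u ?c = v n - k \<and> (\<forall>r<b. u r = v r) \<and>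
            computes ?h (k # map v as) (u ?y)" if "k \<le> v n" for k
          using that
        proof (induction k)
          case 0
          have "\<forall>r<b+4. r \<noteq> ?y \<longrightarrow> v3 r = ?v2 r" using computes_intoD(2)[OF F(2) v3(1)] by blast
          then show ?case using y0 v2as v3(2) by (intro exI[of _ v3]) (auto intro: computes.prec_0 simp del: map_eq_conv)
        next
          case (Suc k)
          then obtain u where u: "(v3, u) \<in> B\<^sup>*" "u ?i = k" "u ?c = v n - k" "\<forall>r<b. u r = v r"
            "computes ?h (k # map v as) (u ?y)" by auto
          have uas: "map u as = map v as" by (rule asb) (rule u(4))
          obtain y where "computes ?h (Suc k # map v as) y"
            using tot[of "v n - Suc k"] Suc.prems by auto
          then obtain y' where y': "computes ?h (k # map v as) y'" "computes g (k # y' # map v as) y"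
            by (rule computes_RPrec_SucE)
          have "y' = u ?y" using y'(1) u(5) by (rule computes_deterministic)
          with y'(2) have "computes g (u ?i # u ?y # map u as) y" by (simp add: u(2) uas del: map_eq_conv)
          moreover have "0 < u ?c" using u(3) Suc.prems by simp
          ultimately obtain w where w: "(u, w) \<in> B" using Bex by blast
          have "computes ?h (Suc k # map v as) (w ?y)"
            using Bstep[OF w] u uas by (auto intro: computes.prec_Suc simp del: map_eq_conv)
          then show ?case
            using Bstep[OF w] u w by (intro exI[of _ w]) (auto intro: rtrancl_into_rtrancl)
        qed
        from this[of "v n"] obtain u where u: "(v3, u) \<in> B\<^sup>*" "u ?c = 0" by auto
        have "(u, u) \<in> op_rel (CZero ?c)" using u(2) by simp
        moreover have "(u, u(?t := 0, out := u ?y)) \<in> copy_rel ?y out ?t" by (auto simp: copy_rel_def)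
        ultimately show "\<exists>v'. (v, v') \<in> ?R" using v12 v3(1) u(1) by blast
      qed
    qed
  qed
qed

lemma compilable: "compilable g"
  by (induction g)
    (auto intro: compilable_RZero compilable_RSucc compilable_RProj compilable_RComp
      compilable_RPrec compilable_RMin)

text \<open>Register 0 holds the input, register 1 the output, the others are scratch. Halting
  becomes reachability of a control state with arbitrary final contents.\<close>

lemma halting_counter_machine:
  obtains T q\<^sub>0 q\<^sub>f where "finite T"
    "\<And>n. (\<exists>z. computes g [n] z) \<longleftrightarrow>
      (\<exists>v. ((q\<^sub>0, (\<lambda>_. 0)(0 := n)), (q\<^sub>f, v)) \<in> (trans_rel T)\<^sup>*)"
proof -
  obtain R where R: "recognizable R" "computes_into R g [0] 1 2"
    using compilable by (rule compilableE[of g "[0]" 2 1]) auto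
  from R(1) obtain T q\<^sub>0 q\<^sub>f where T: "finite T"
    "\<And>v v'. (v, v') \<in> R \<longleftrightarrow> ((q\<^sub>0, v), (q\<^sub>f, v')) \<in> (trans_rel T)\<^sup>*"
    unfolding recognizable_def by blast
  have "(\<exists>z. computes g [n] z) \<longleftrightarrow> (\<exists>v. ((\<lambda>_. 0)(0 := n), v) \<in> R)" for n
    using R(2) unfolding computes_into_def
    by (metis fun_upd_same list.simps(8) list.simps(9))
  then show ?thesis using that T by simp
qed

section \<open>Words and derived connectives\<close>

abbreviation "fm_and \<phi> \<psi> \<equiv> Neg (Or (Neg \<phi>) (Neg \<psi>))"
abbreviation "fm_imp \<phi> \<psi> \<equiv> Or (Neg \<phi>) \<psi>"
abbreviation "fm_all x \<phi> \<equiv> Neg (Ex x (Neg \<phi>))"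

text \<open>Falsity is written as a closed formula over variable 0, so that empty disjunctions do
  not bring in a third variable.\<close>

primrec disj :: "fm list \<Rightarrow> fm" where
  "disj [] = Ex 0 (Neg (Eq 0 0))"
| "disj (\<phi> # \<phi>s) = Or \<phi> (disj \<phi>s)"

definition conj :: "fm list \<Rightarrow> fm" where
  "conj \<phi>s = Neg (disj (map Neg \<phi>s))"

lemma sat_disj [simp]: "sat P w \<nu> (disj \<phi>s) \<longleftrightarrow> (\<exists>\<phi>\<in>set \<phi>s. sat P w \<nu> \<phi>)"
  by (induction \<phi>s) auto

lemma vars_disj [simp]: "vars (disj \<phi>s) = insert 0 (\<Union>\<phi>\<in>set \<phi>s. vars \<phi>)"
  by (induction \<phi>s) auto

lemma free_vars_disj [simp]: "free_vars (disj \<phi>s) = (\<Union>\<phi>\<in>set \<phi>s. free_vars \<phi>)"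
  by (induction \<phi>s) auto

lemma actions_disj [simp]: "actions (disj \<phi>s) = (\<Union>\<phi>\<in>set \<phi>s. actions \<phi>)"
  by (induction \<phi>s) auto

lemma sat_conj [simp]: "sat P w \<nu> (conj \<phi>s) \<longleftrightarrow> (\<forall>\<phi>\<in>set \<phi>s. sat P w \<nu> \<phi>)"
  by (simp add: conj_def)

lemma vars_conj [simp]: "vars (conj \<phi>s) = insert 0 (\<Union>\<phi>\<in>set \<phi>s. vars \<phi>)"
  by (simp add: conj_def)

lemma free_vars_conj [simp]: "free_vars (conj \<phi>s) = (\<Union>\<phi>\<in>set \<phi>s. free_vars \<phi>)"
  by (simp add: conj_def)

lemma actions_conj [simp]: "actions (conj \<phi>s) = (\<Union>\<phi>\<in>set \<phi>s. actions \<phi>)"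
  by (simp add: conj_def)

lemma positions_ge_1: "i \<in> positions w \<Longrightarrow> 1 \<le> i"
  by (cases w) auto

lemma positions_downward: "i \<in> positions w \<Longrightarrow> 1 \<le> j \<Longrightarrow> j \<le> i \<Longrightarrow> j \<in> positions w"
  by (cases w) auto

lemma length_prefix: "n = 0 \<or> n \<in> positions w \<Longrightarrow> length (prefix w n) = n"
  by (cases w) auto

lemma prefix_nth: "Suc i \<le> n \<Longrightarrow> Suc i \<in> positions w \<Longrightarrow> prefix w n ! i = letter w (Suc i)"
  by (cases w) auto

lemma take_prefix: "m \<le> n \<Longrightarrow> take m (prefix w n) = prefix w m"
  by (cases w) (auto simp: take_map min_def)

lemma prefix_Suc: "Suc n \<in> positions w \<Longrightarrow> prefix w (Suc n) = prefix w n @ [letter w (Suc n)]"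
  by (cases w) (auto simp: take_Suc_conv_app_nth)

lemma set_prefix: "set (prefix w n) = letter w ` {i \<in> positions w. i \<le> n}"
proof (cases w)
  case (Fin u)
  show ?thesis
  proof (intro set_eqI iffI)
    fix e assume "e \<in> set (prefix w n)"
    then obtain i where "i < length u" "i < n" "e = u ! i"
      by (auto simp: Fin in_set_conv_nth)
    then show "e \<in> letter w ` {i \<in> positions w. i \<le> n}"
      by (auto simp: Fin intro!: image_eqI[of _ _ "Suc i"])
  next
    fix e assume "e \<in> letter w ` {i \<in> positions w. i \<le> n}"
    then obtain i where "1 \<le> i" "i \<le> length u" "i \<le> n" "e = u ! (i - 1)" by (auto simp: Fin)
    then show "e \<in> set (prefix w n)"
      by (auto simp: Fin in_set_conv_nth intro!: exI[of _ "i - 1"])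
  qed
next
  case (Inf v)
  show ?thesis
  proof (intro set_eqI iffI)
    fix e assume "e \<in> set (prefix w n)"
    then obtain i where "i < n" "e = v i"
      by (auto simp: Inf)
    then show "e \<in> letter w ` {i \<in> positions w. i \<le> n}"
      by (auto simp: Inf intro!: image_eqI[of _ _ "Suc i"])
  next
    fix e assume "e \<in> letter w ` {i \<in> positions w. i \<le> n}"
    then show "e \<in> set (prefix w n)"
      by (force simp: Inf)
  qed
qed

lemma ex_universe:
  "(\<exists>d\<in>universe P w. Q d) \<longleftrightarrow> (\<exists>p\<in>procs P. Q (Inl p)) \<or> (\<exists>i\<in>positions w. Q (Inr i))"
  unfolding universe_def Plus_def by auto

text \<open>The least equivalence lies inside the kernel of the map that sends each element to its
  process, because this kernel is an equivalence containing all generating pairs. The processes of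
  the letters lie in the universe since \<open>w\<close> is an execution.\<close>

lemma same_proc_positions:
  assumes "execution As Ae P w" "i \<in> positions w" "j \<in> positions w"
  shows "(Inr i, Inr j) \<in> same_proc P w \<longleftrightarrow> snd (letter w i) = snd (letter w j)"
proof
  let ?proc = "case_sum (\<lambda>p. p) (\<lambda>i. snd (letter w i))"
  let ?r = "{(x, y). x \<in> universe P w \<and> y \<in> universe P w \<and> ?proc x = ?proc y}"
  have "snd (letter w i) \<in> procs P" if "i \<in> positions w" for i
    using assms(1) that
    by (fastforce simp: execution_def events_def sys_events_def env_events_def procs_def)
  then have "equiv (universe P w) ?r \<and>
      {(Inl (snd (letter w i)), Inr i) | i. i \<in> positions w} \<subseteq> ?r \<and>
      {(Inr i, Inr j) | i j. i \<in> positions w \<and> j \<in> positions w \<and>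
        snd (letter w i) = snd (letter w j)} \<subseteq> ?r"
    by (auto simp: equiv_def refl_on_def sym_on_def trans_on_def universe_def)
  moreover assume "(Inr i, Inr j) \<in> same_proc P w"
  ultimately have "(Inr i, Inr j) \<in> ?r"
    unfolding same_proc_def by (elim InterD) simp
  then show "snd (letter w i) = snd (letter w j)" by simp
next
  assume "snd (letter w i) = snd (letter w j)"
  then show "(Inr i, Inr j) \<in> same_proc P w"
    using assms(2,3) unfolding same_proc_def by blast
qed

section \<open>Fair continuations\<close>

text \<open>After the history \<open>u\<close> Environment stays silent while System obeys
  \<open>f\<close>. Either \<open>f\<close> eventually returns \<open>None\<close> and the word
  ends, or System moves forever; the word is fair in both cases. It is applied to the empty history
  and to one that ends in a challenge by Environment.\<close>

lemma fair_continuation: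
  assumes f: "strategy As Ae P f"
    and u: "set u \<subseteq> events As Ae P"
      "\<And>i. i < length u \<Longrightarrow> u ! i \<in> sys_events As P \<Longrightarrow> f (take i u) = Some (u ! i)"
  obtains w where "execution As Ae P w" "compatible As P f w" "fair As P f w"
    "length u = 0 \<or> length u \<in> positions w" "prefix w (length u) = u"
    "\<And>i. i \<in> positions w \<Longrightarrow> length u < i \<Longrightarrow> letter w i \<in> sys_events As P"
proof -
  define ok where "ok x \<longleftrightarrow> length u \<le> length x \<and> take (length u) x = u \<and> set x \<subseteq> events As Ae P \<and>
    (\<forall>i<length x. x ! i \<in> sys_events As P \<longrightarrow> f (take i x) = Some (x ! i)) \<and>
    (\<forall>i<length x. length u \<le> i \<longrightarrow> x ! i \<in> sys_events As P)" for x
  \<comment> \<open>Iteration becomes stationary once \<open>f\<close> returns \<open>None\<close>,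
    so one sequence serves both cases.\<close>
  define g where "g x = (case f x of None \<Rightarrow> x | Some e \<Rightarrow> x @ [e])" for x
  define U where "U k = (g ^^ k) u" for k
  have U: "U 0 = u" "U (Suc k) = (case f (U k) of None \<Rightarrow> U k | Some e \<Rightarrow> U k @ [e])" for k
    by (simp_all add: U_def g_def split: option.split)
  have ok: "ok (U k)" for k
  proof (induction k)
    case 0
    show ?case using u by (simp add: ok_def U)
  next
    case (Suc k)
    show ?case
    proof (cases "f (U k)")
      case None
      then show ?thesis using Suc by (simp add: U)
    next
      case (Some e)
      have "U k \<in> lists (events As Ae P)" using Suc by (auto simp: ok_def)
      then have "f (U k) \<in> Some ` sys_events As P \<union> {None}"
        using f unfolding strategy_def by blast
      then have "e \<in> sys_events As P" using Some by auto
      then show ?thesis using Suc Some by (auto simp: ok_def U events_def nth_append less_Suc_eq)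
    qed
  qed
  show ?thesis
  proof (cases "\<exists>k. f (U k) = None")
    case True
    then obtain k where k: "f (U k) = None" by blast
    show ?thesis
    proof (rule that[of "Fin (U k)"])
      show "execution As Ae P (Fin (U k))"
        using ok[of k] by (auto simp: ok_def execution_def intro!: subsetD[OF _ nth_mem])
      show "compatible As P f (Fin (U k))"
        using ok[of k] by (auto simp: ok_def compatible_def)
      show "fair As P f (Fin (U k))" using k by simp
      show "length u = 0 \<or> length u \<in> positions (Fin (U k))"
        using ok[of k] by (auto simp: ok_def Suc_le_eq)
      show "prefix (Fin (U k)) (length u) = u" using ok[of k] by (simp add: ok_def)
      show "letter (Fin (U k)) i \<in> sys_events As P" if "i \<in> positions (Fin (U k))" "length u < i" for i
        using ok[of k] that by (auto simp: ok_def)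
    qed
  next
    case False
    have US: "\<exists>e. U (Suc k) = U k @ [e]" for k
      using False by (metis U(2) not_None_eq option.simps(5))
    have len: "length (U k) = length u + k" for k
    proof (induction k)
      case (Suc k)
      then show ?case using US[of k] by auto
    qed (simp add: U)
    have ext: "take (length (U k)) (U (k + m)) = U k" for k m
    proof (induction m)
      case (Suc m)
      then show ?case using US[of "k + m"] by (auto simp: len)
    qed simp
    \<comment> \<open>The histories \<open>U k\<close> extend one another, so a letter of the limit
      can be read off any history that is long enough.\<close>
    define v where "v i = U (Suc i) ! i" for i
    have v: "v i = U k ! i" if "i < length (U k)" for i k
    proof (cases "k \<le> Suc i")
      case True
      then show ?thesis
        using ext[of k "Suc i - k"] that unfolding v_def by (metis le_add_diff_inverse nth_take)
    next
      case False
      then have "U (Suc i) ! i = take (length (U (Suc i))) (U k) ! i"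
        using ext[of "Suc i" "k - Suc i"] by simp
      then show ?thesis by (simp add: v_def len)
    qed
    have pre: "map v [0..<i] = take i (U k)" if "i \<le> length (U k)" for i k
      using that by (intro nth_equalityI) (auto simp: v)
    show ?thesis
    proof (rule that[of "Inf v"])
      show "execution As Ae P (Inf v)"
        unfolding execution_def
      proof
        fix i assume "i \<in> positions (Inf v)"
        then have "letter (Inf v) i = U i ! (i - 1)" "i - 1 < length (U i)" by (auto simp: v len)
        then show "letter (Inf v) i \<in> events As Ae P"
          using ok[of i] unfolding ok_def by (metis nth_mem subsetD)
      qed
      show "compatible As P f (Inf v)"
        unfolding compatible_def
      proof (intro ballI impI)
        fix i assume i: "i \<in> positions (Inf v)" "letter (Inf v) i \<in> sys_events As P"
        then have *: "letter (Inf v) i = U i ! (i - 1)" "i - 1 < length (U i)" by (auto simp: v len)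
        have "prefix (Inf v) (i - 1) = take (i - 1) (U i)" using * by (simp add: pre)
        then show "f (prefix (Inf v) (i - 1)) = Some (letter (Inf v) i)"
          using ok[of i] i * unfolding ok_def by metis
      qed
      show sys: "letter (Inf v) i \<in> sys_events As P" if "i \<in> positions (Inf v)" "length u < i" for i
      proof -
        have "letter (Inf v) i = U i ! (i - 1)" "i - 1 < length (U i)" "length u \<le> i - 1"
          using that by (auto simp: v len)
        then show ?thesis using ok[of i] unfolding ok_def by metis
      qed
      have "{length u + 1..} \<subseteq> {j \<in> positions (Inf v). letter (Inf v) j \<in> sys_events As P}"
        using sys by auto
      then have "infinite {j \<in> positions (Inf v). letter (Inf v) j \<in> sys_events As P}"
        using infinite_Ici infinite_super by blast
      then show "fair As P f (Inf v)" by simp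
      show "length u = 0 \<or> length u \<in> positions (Inf v)" by (auto simp: Suc_le_eq)
      show "prefix (Inf v) (length u) = u" using pre[of "length u" 0] by (simp add: U)
    qed
  qed
qed

section \<open>The game of a counter machine\<close>

text \<open>Action \<open>0\<close> belongs to the environment; every other action is a transition. Action \<open>1\<close> loads
  the input into counter \<open>0\<close>, and action \<open>2\<close> starts the machine.\<close>

locale counter_game =
  fixes tr :: "nat \<Rightarrow> trans" and acts :: "nat list" and q\<^sub>0 q\<^sub>f :: nat
  assumes acts: "0 \<notin> set acts" "1 \<in> set acts" "2 \<in> set acts"
    and tr_load: "tr 1 = (0, CInc 0, 0)"
    and tr_start: "tr 2 = (0, CNop, q\<^sub>0)"
    and src_nonzero: "a \<in> set acts \<Longrightarrow> a \<notin> {1, 2} \<Longrightarrow> fst (tr a) \<noteq> 0"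
    and tgt_nonzero: "a \<in> set acts \<Longrightarrow> a \<noteq> 1 \<Longrightarrow> snd (snd (tr a)) \<noteq> 0"
    and final_nonzero: "q\<^sub>f \<noteq> 0"
begin

abbreviation "src a \<equiv> fst (tr a)"
abbreviation "opn a \<equiv> fst (snd (tr a))"
abbreviation "tgt a \<equiv> snd (snd (tr a))"

definition inced :: "nat \<Rightarrow> 'p event list \<Rightarrow> 'p set" where
  "inced c u = {p. \<exists>a\<in>set acts. (a, p) \<in> set u \<and> opn a = CInc c}"

definition deced :: "nat \<Rightarrow> 'p event list \<Rightarrow> 'p set" where
  "deced c u = {p. \<exists>a\<in>set acts. (a, p) \<in> set u \<and> opn a = CDec c}"

definition live :: "nat \<Rightarrow> 'p event list \<Rightarrow> 'p set" where
  "live c u = inced c u - deced c u"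

definition val :: "'p event list \<Rightarrow> valn" where
  "val u = (\<lambda>c. card (live c u))"

text \<open>The part of legality that two variables can express. The condition on zero tests is
  added separately in \<open>legal\<close>, because only the challenges of Environment enforce
  it.\<close>

definition wellformed :: "'p event list \<Rightarrow> nat \<Rightarrow> 'p \<Rightarrow> bool" where
  "wellformed u a p \<longleftrightarrow> (\<forall>c. opn a = CInc c \<longrightarrow> (\<forall>d. p \<notin> inced d u)) \<and>
     (\<forall>c. opn a = CDec c \<longrightarrow> p \<in> inced c u \<and> (\<forall>d. p \<notin> deced d u))"

definition legal :: "'p event list \<Rightarrow> bool" where
  "legal u \<longleftrightarrow> (\<forall>i<length u. fst (u ! i) \<in> set acts \<and> wellformed (take i u) (fst (u ! i)) (snd (u ! i)) \<and>
     (\<forall>c. opn (fst (u ! i)) = CZero c \<longrightarrow> live c (take i u) = {}))"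

definition chained :: "'p event list \<Rightarrow> bool" where
  "chained u \<longleftrightarrow> (\<forall>i. Suc i < length u \<longrightarrow> tgt (fst (u ! i)) = src (fst (u ! Suc i)))"

definition loads :: "nat \<Rightarrow> 'p event list \<Rightarrow> bool" where
  "loads n u \<longleftrightarrow> n < length u \<and> (\<forall>i<n. fst (u ! i) = 1) \<and> fst (u ! n) = 2"

definition accepting :: "nat \<Rightarrow> 'p event list \<Rightarrow> bool" where
  "accepting n u \<longleftrightarrow> legal u \<and> chained u \<and> loads n u \<and> tgt (fst (last u)) = q\<^sub>f"

lemma legal_snoc:
  "legal (u @ [(a, p)]) \<longleftrightarrow> legal u \<and> a \<in> set acts \<and> wellformed u a p \<and>
     (\<forall>c. opn a = CZero c \<longrightarrow> live c u = {})"
  by (auto simp: legal_def nth_append less_Suc_eq)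

lemma legal_take: "legal u \<Longrightarrow> legal (take i u)"
  by (auto simp: legal_def min_def)

lemma inced_snoc:
  "inced c (u @ [(a, p)]) = (if a \<in> set acts \<and> opn a = CInc c then insert p (inced c u) else inced c u)"
  by (auto simp: inced_def)

lemma deced_snoc:
  "deced c (u @ [(a, p)]) = (if a \<in> set acts \<and> opn a = CDec c then insert p (deced c u) else deced c u)"
  by (auto simp: deced_def)

lemma finite_inced: "finite (inced c u)"
  by (rule finite_subset[of _ "snd ` set u"]) (force simp: inced_def)+

lemma inced_subset: "inced c u \<subseteq> snd ` set u"
  by (force simp: inced_def)

text \<open>An increment needs a process never incremented for any counter, and a decrement needs
  one incremented for the same counter. So each process belongs to at most one counter
  throughout.\<close>

lemma legal_invariants:
  "legal u \<Longrightarrow> deced c u \<subseteq> inced c u \<and> (c \<noteq> d \<longrightarrow> inced c u \<inter> inced d u = {})"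
proof (induction u arbitrary: c d rule: rev_induct)
  case Nil
  show ?case by (auto simp: deced_def inced_def)
next
  case (snoc e u)
  obtain a p where e: "e = (a, p)" by fastforce
  from snoc.prems have u: "legal u" and w: "wellformed u a p" by (auto simp: e legal_snoc)
  from snoc.IH[OF u] w show ?case
    by (cases "opn a") (auto simp: e inced_snoc deced_snoc wellformed_def)
qed

text \<open>This justifies counting live processes: an increment adds a process new to all counters,
  a decrement removes a live one, and no other counter is affected.\<close>

lemma legal_step:
  assumes "legal (u @ [(a, p)])"
  shows "(val u, val (u @ [(a, p)])) \<in> op_rel (opn a)"
proof -
  have u: "legal u" and a: "a \<in> set acts" and w: "wellformed u a p"
    and z: "\<And>c. opn a = CZero c \<Longrightarrow> live c u = {}"
    using assms by (auto simp: legal_snoc)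
  have dec: "deced c u \<subseteq> inced c u" for c using legal_invariants[OF u] by blast
  have fin: "finite (live c u)" for c by (simp add: live_def finite_inced)
  show ?thesis
  proof (cases "opn a")
    case (CInc c)
    then have p: "p \<notin> inced d u" "p \<notin> deced d u" for d using w dec by (auto simp: wellformed_def)
    have "live d (u @ [(a, p)]) = (if d = c then insert p (live c u) else live d u)" for d
      using p a CInc by (auto simp: live_def inced_snoc deced_snoc)
    moreover have "p \<notin> live c u" using p by (simp add: live_def)
    ultimately have "val (u @ [(a, p)]) = (val u)(c := Suc (val u c))"
      using fin by (auto simp: val_def)
    then show ?thesis using CInc by auto
  next
    case (CDec c)
    then have p: "p \<in> live c u" using w by (auto simp: wellformed_def live_def)
    have "live d (u @ [(a, p)]) = (if d = c then live c u - {p} else live d u)" for d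
      using a CDec by (auto simp: live_def inced_snoc deced_snoc)
    then have "val (u @ [(a, p)]) = (val u)(c := val u c - 1)"
      using fin p by (auto simp: val_def)
    moreover have "0 < val u c" using p fin by (auto simp: val_def card_gt_0_iff)
    ultimately show ?thesis using CDec by auto
  next
    case (CZero c)
    then have "live d (u @ [(a, p)]) = live d u" for d by (auto simp: live_def inced_snoc deced_snoc)
    then have "val (u @ [(a, p)]) = val u" by (simp add: val_def)
    moreover have "val u c = 0" using z CZero by (simp add: val_def)
    ultimately show ?thesis using CZero by auto
  next
    case CNop
    then have "live d (u @ [(a, p)]) = live d u" for d by (auto simp: live_def inced_snoc deced_snoc)
    then have "val (u @ [(a, p)]) = val u" by (simp add: val_def)
    then show ?thesis using CNop by auto
  qed
qed

lemma val_Nil: "val [] = (\<lambda>_. 0)"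
  by (simp add: val_def live_def inced_def)

lemma op_rel_functional: "(v, v') \<in> op_rel m \<Longrightarrow> (v, v'') \<in> op_rel m \<Longrightarrow> v' = v''"
  by (cases m) auto

definition machine :: "trans set" where
  "machine = tr ` (set acts - {1, 2})"

text \<open>The first \<open>n\<close> events load the input and action 2 enters
  \<open>q\<^sub>0\<close>. Control never returns to state 0 afterwards, so all later events are
  transitions of the machine.\<close>

lemma accepting_imp_path:
  assumes "accepting n u"
  shows "\<exists>v. ((q\<^sub>0, (\<lambda>_. 0)(0 := n)), (q\<^sub>f, v)) \<in> (trans_rel machine)\<^sup>*"
proof -
  have leg: "legal u" and ch: "chained u" and ld: "loads n u" and fin: "tgt (fst (last u)) = q\<^sub>f"
    using assms by (auto simp: accepting_def)
  have step: "(val (take k u), val (take (Suc k) u)) \<in> op_rel (opn (fst (u ! k)))" if "k < length u" for k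
  proof -
    have "take (Suc k) u = take k u @ [(fst (u ! k), snd (u ! k))]"
      using that by (simp add: take_Suc_conv_app_nth)
    then show ?thesis using legal_step legal_take[OF leg, of "Suc k"] by metis
  qed
  have val: "val (take i u) = (\<lambda>_. 0)(0 := i)" if "i \<le> n" for i
    using that
  proof (induction i)
    case 0
    show ?case by (auto simp: val_Nil)
  next
    case (Suc i)
    then have "i < length u" "fst (u ! i) = 1" using ld by (auto simp: loads_def)
    then show ?case using step[of i] Suc tr_load by auto
  qed
  \<comment> \<open>That the action differs from 1 is carried along because its target is then
    nonzero, whereas actions 1 and 2 start in state 0.\<close>
  have path: "((q\<^sub>0, (\<lambda>_. 0)(0 := n)), (tgt (fst (u ! k)), val (take (Suc k) u))) \<in> (trans_rel machine)\<^sup>* \<and>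
      fst (u ! k) \<noteq> 1"
    if "n \<le> k" "k < length u" for k
    using that
  proof (induction k rule: nat_induct_at_least)
    case base
    have 2: "fst (u ! n) = 2" using ld by (simp add: loads_def)
    then have "val (take (Suc n) u) = (\<lambda>_. 0)(0 := n)"
      using step[OF base] val[of n] tr_start by simp
    then show ?case using 2 tr_start by simp
  next
    case (Suc k)
    then have IH: "((q\<^sub>0, (\<lambda>_. 0)(0 := n)), (tgt (fst (u ! k)), val (take (Suc k) u))) \<in> (trans_rel machine)\<^sup>*"
      "fst (u ! k) \<noteq> 1" using Suc_lessD by blast+
    let ?a = "fst (u ! Suc k)"
    have a: "?a \<in> set acts" "fst (u ! k) \<in> set acts" using leg Suc.prems by (auto simp: legal_def)
    have s: "tgt (fst (u ! k)) = src ?a" using ch Suc.prems by (simp add: chained_def)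
    then have "src ?a \<noteq> 0" using tgt_nonzero a(2) IH(2) by metis
    then have na: "?a \<notin> {1, 2}" using tr_load tr_start by auto
    have "(src ?a, opn ?a, tgt ?a) \<in> machine" using a(1) na by (auto simp: machine_def)
    then have "((src ?a, val (take (Suc k) u)), (tgt ?a, val (take (Suc (Suc k)) u))) \<in> trans_rel machine"
      using step[OF Suc.prems] by (rule trans_relI)
    then show ?case using rtrancl_into_rtrancl[OF IH(1)[unfolded s]] na by blast
  qed
  have "u \<noteq> []" "n \<le> length u - 1" "length u - 1 < length u" using ld by (auto simp: loads_def)
  then show ?thesis using path[of "length u - 1"] fin last_conv_nth[of u] by metis
qed

text \<open>An increment takes the process \<open>length u\<close>, fresh because all names so far
  are smaller; a decrement takes a live process. The bound on names is what limits the number of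
  processes needed for a run.\<close>

lemma legal_extend:
  fixes u :: "nat event list"
  assumes "legal u" "snd ` set u \<subseteq> {..<length u}" "a \<in> set acts" "(val u, v') \<in> op_rel (opn a)"
  obtains p where "legal (u @ [(a, p)])" "snd ` set (u @ [(a, p)]) \<subseteq> {..<length (u @ [(a, p)])}"
    "val (u @ [(a, p)]) = v'"
proof -
  have fin: "finite (live c u)" for c by (simp add: live_def finite_inced)
  have "\<exists>p \<le> length u. wellformed u a p \<and> (\<forall>c. opn a = CZero c \<longrightarrow> live c u = {})"
  proof (cases "opn a")
    case (CInc c)
    then show ?thesis using inced_subset[of _ u] assms(2)
      by (intro exI[of _ "length u"]) (force simp: wellformed_def)
  next
    case (CDec c)
    then have "0 < val u c" using assms(4) by auto
    then obtain p where p: "p \<in> inced c u" "p \<notin> deced c u" by (force simp: val_def card_gt_0_iff live_def)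
    have "p \<notin> deced d u" for d using p legal_invariants[OF assms(1)] by (cases "d = c") blast+
    then show ?thesis using p CDec inced_subset[of c u] assms(2)
      by (intro exI[of _ p]) (force simp: wellformed_def)
  next
    case (CZero c)
    then have "val u c = 0" using assms(4) by auto
    then show ?thesis using CZero fin by (auto simp: wellformed_def val_def)
  qed (auto simp: wellformed_def)
  then obtain p where p: "p \<le> length u" "wellformed u a p" "\<forall>c. opn a = CZero c \<longrightarrow> live c u = {}"
    by blast
  then have "legal (u @ [(a, p)])" using assms by (simp add: legal_snoc)
  moreover from legal_step[OF this] have "val (u @ [(a, p)]) = v'"
    using assms(4) by (rule op_rel_functional)
  moreover have "snd ` set (u @ [(a, p)]) \<subseteq> {..<length (u @ [(a, p)])}"
    using p(1) assms(2) by auto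
  ultimately show ?thesis using that by blast
qed

lemma path_imp_accepting:
  assumes "((q\<^sub>0, (\<lambda>_. 0)(0 := n)), (q\<^sub>f, v)) \<in> (trans_rel machine)\<^sup>*"
  obtains u :: "nat event list" where "accepting n u" "snd ` set u \<subseteq> {..<length u}"
proof -
  \<comment> \<open>The loading phase: \<open>k\<close> events with action 1 on new processes bring
    counter 0 to \<open>k\<close>.\<close>
  have "\<exists>u :: nat event list. legal u \<and> length u = k \<and> (\<forall>i<k. fst (u ! i) = 1) \<and>
      snd ` set u \<subseteq> {..<length u} \<and> val u = (\<lambda>_. 0)(0 := k)" for k
  proof (induction k)
    case 0
    show ?case by (auto simp: legal_def val_Nil)
  next
    case (Suc k)
    then obtain u :: "nat event list" where u: "legal u" "length u = k" "\<forall>i<k. fst (u ! i) = 1"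
      "snd ` set u \<subseteq> {..<length u}" "val u = (\<lambda>_. 0)(0 := k)" by blast
    have "(val u, (\<lambda>_. 0)(0 := Suc k)) \<in> op_rel (opn 1)"
      using tr_load by (auto simp: u(5) intro!: exI[of _ "(\<lambda>_. 0)(0 := k)"])
    from legal_extend[OF u(1,4) acts(2) this] obtain p where
      "legal (u @ [(1, p)])" "snd ` set (u @ [(1, p)]) \<subseteq> {..<length (u @ [(1, p)])}"
      "val (u @ [(1, p)]) = (\<lambda>_. 0)(0 := Suc k)" .
    then show ?case using u(2,3) by (intro exI[of _ "u @ [(1, p)]"]) (auto simp: nth_append less_Suc_eq)
  qed
  then obtain u :: "nat event list" where u: "legal u" "length u = n" "\<forall>i<n. fst (u ! i) = 1"
    "snd ` set u \<subseteq> {..<length u}" "val u = (\<lambda>_. 0)(0 := n)" by blast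
  have "(val u, (\<lambda>_. 0)(0 := n)) \<in> op_rel (opn 2)" using tr_start u(5) by simp
  from legal_extend[OF u(1,4) acts(3) this] obtain p where
    p: "legal (u @ [(2, p)])" "snd ` set (u @ [(2, p)]) \<subseteq> {..<length (u @ [(2, p)])}"
    "val (u @ [(2, p)]) = (\<lambda>_. 0)(0 := n)" .
  \<comment> \<open>Induction along the path; the loading phase closed by action 2 is the base
    case.\<close>
  have "\<exists>x :: nat event list. legal x \<and> chained x \<and> loads n x \<and> snd ` set x \<subseteq> {..<length x} \<and>
      tgt (fst (last x)) = q \<and> val x = y"
    if "((q\<^sub>0, (\<lambda>_. 0)(0 := n)), (q, y)) \<in> (trans_rel machine)\<^sup>*" for q y
    using that
  proof (induction rule: rtrancl_induct2)
    case refl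
    have "chained (u @ [(2, p)])"
      unfolding chained_def
    proof (intro allI impI)
      fix i assume "Suc i < length (u @ [(2, p)])"
      then have i: "i < n" "Suc i < n \<or> Suc i = n" using u(2) by auto
      then have "src (fst ((u @ [(2, p)]) ! Suc i)) = 0"
        using u(2,3) tr_load tr_start by (auto simp: nth_append)
      then show "tgt (fst ((u @ [(2, p)]) ! i)) = src (fst ((u @ [(2, p)]) ! Suc i))"
        using i u(2,3) tr_load by (simp add: nth_append)
    qed
    moreover have "loads n (u @ [(2, p)])" using u(2,3) by (auto simp: loads_def nth_append)
    ultimately show ?case using p tr_start by (intro exI[of _ "u @ [(2, p)]"]) simp
  next
    case (step q y r z)
    then obtain x :: "nat event list" where x: "legal x" "chained x" "loads n x"
      "snd ` set x \<subseteq> {..<length x}" "tgt (fst (last x)) = q" "val x = y" by blast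
    from step.hyps(2) obtain m where m: "(q, m, r) \<in> machine" "(y, z) \<in> op_rel m"
      by (auto simp: trans_rel_def)
    then obtain a where "a \<in> set acts" "tr a = (q, m, r)"
      unfolding machine_def by (metis DiffE imageE)
    then have a: "a \<in> set acts" "src a = q" "tgt a = r" "(y, z) \<in> op_rel (opn a)"
      using m(2) by simp_all
    from legal_extend[OF x(1,4) a(1) a(4)[folded x(6)]] obtain p' where
      p': "legal (x @ [(a, p')])" "snd ` set (x @ [(a, p')]) \<subseteq> {..<length (x @ [(a, p')])}"
      "val (x @ [(a, p')]) = z" .
    have ne: "x \<noteq> []" using x(3) by (auto simp: loads_def)
    have "chained (x @ [(a, p')])"
      unfolding chained_def
    proof (intro allI impI)
      fix i assume i: "Suc i < length (x @ [(a, p')])"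
      show "tgt (fst ((x @ [(a, p')]) ! i)) = src (fst ((x @ [(a, p')]) ! Suc i))"
      proof (cases "Suc i < length x")
        case True
        then show ?thesis using x(2) by (simp add: chained_def nth_append)
      next
        case False
        then have "Suc i = length x" using i by simp
        then have "x ! i = last x" using ne by (metis diff_Suc_1 last_conv_nth)
        then show ?thesis using \<open>Suc i = length x\<close> x(5) a(2) by (simp add: nth_append)
      qed
    qed
    moreover have "loads n (x @ [(a, p')])" using x(3) by (auto simp: loads_def nth_append)
    ultimately show ?case using p' a by (intro exI[of _ "x @ [(a, p')]"]) simp
  qed
  from this[OF assms] show ?thesis using that by (auto simp: accepting_def)
qed

end

section \<open>Formulas for the input\<close>

definition env_fm :: fm where
  "env_fm = Ex 0 (Act 0 0)"

text \<open>Two variables suffice to walk along the word: the successor is bound to variable 1 and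
  copied back to 0, where the recursive formula expects it.\<close>

primrec input_at :: "nat \<Rightarrow> fm" where
  "input_at 0 = Act 2 0"
| "input_at (Suc n) = fm_and (Act 1 0) (Ex 1 (fm_and (Succ 0 1) (Ex 0 (fm_and (Eq 0 1) (input_at n)))))"

definition input_fm :: "nat \<Rightarrow> fm" where
  "input_fm n = Or env_fm (Ex 0 (fm_and (Neg (Ex 1 (Less 1 0))) (input_at n)))"

lemma input_at_props:
  "vars (input_at n) \<subseteq> {0, 1}" "free_vars (input_at n) = {0}" "actions (input_at n) \<subseteq> {1, 2}"
  by (induction n) auto

lemma sat_input_at:
  assumes "\<nu> 0 = Inr i" "i \<in> positions w"
  shows "sat P w \<nu> (input_at n) \<longleftrightarrow> (\<forall>k<n. i + k \<in> positions w \<and> fst (letter w (i + k)) = 1) \<and>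
    i + n \<in> positions w \<and> fst (letter w (i + n)) = 2"
  using assms
proof (induction n arbitrary: \<nu> i)
  case 0
  then show ?case by auto
next
  case (Suc n)
  have IH: "i + 1 \<in> positions w \<Longrightarrow> sat P w (\<nu>(1 := Inr (i + 1), 0 := Inr (i + 1))) (input_at n) \<longleftrightarrow>
     (\<forall>k<n. i + 1 + k \<in> positions w \<and> fst (letter w (i + 1 + k)) = 1) \<and>
     i + 1 + n \<in> positions w \<and> fst (letter w (i + 1 + n)) = 2"
    by (rule Suc.IH) simp_all
  have "sat P w \<nu> (input_at (Suc n)) \<longleftrightarrow> fst (letter w i) = 1 \<and> i + 1 \<in> positions w \<and>
      sat P w (\<nu>(1 := Inr (i + 1), 0 := Inr (i + 1))) (input_at n)"
    using Suc.prems by (auto simp: ex_universe universe_def InrI)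
  also have "\<dots> \<longleftrightarrow> fst (letter w i) = 1 \<and> i + 1 \<in> positions w \<and>
     (\<forall>k<n. i + 1 + k \<in> positions w \<and> fst (letter w (i + 1 + k)) = 1) \<and>
     i + 1 + n \<in> positions w \<and> fst (letter w (i + 1 + n)) = 2"
    using IH by blast
  also have "\<dots> \<longleftrightarrow> (\<forall>k<Suc n. i + k \<in> positions w \<and> fst (letter w (i + k)) = 1) \<and>
     i + Suc n \<in> positions w \<and> fst (letter w (i + Suc n)) = 2"
    using Suc.prems positions_downward[of "i + 1 + n" w "i + 1"] positions_ge_1[of i w]
    by (auto simp: All_less_Suc2)
  finally show ?case .
qed

definition has_env :: "'p event word \<Rightarrow> bool" where
  "has_env w \<longleftrightarrow> (\<exists>i\<in>positions w. fst (letter w i) = 0)"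

lemma sat_env_fm: "sat P w \<nu> env_fm \<longleftrightarrow> has_env w"
  by (auto simp: env_fm_def ex_universe has_env_def)

lemma models_input_fm:
  "models P w (input_fm n) \<longleftrightarrow> has_env w \<or>
    (Suc n \<in> positions w \<and> (\<forall>k<n. fst (letter w (Suc k)) = 1) \<and> fst (letter w (Suc n)) = 2)"
proof -
  have first: "(\<exists>d\<in>universe P w. sat P w (\<nu>(0 := d)) (fm_and (Neg (Ex 1 (Less 1 0))) (input_at n))) \<longleftrightarrow>
     (\<forall>k<n. 1 + k \<in> positions w \<and> fst (letter w (1 + k)) = 1) \<and>
       1 + n \<in> positions w \<and> fst (letter w (1 + n)) = 2" (is "?L \<longleftrightarrow> ?R") for \<nu>
  proof
    assume ?L
    then obtain d where d: "d \<in> universe P w" "\<not> sat P w (\<nu>(0 := d)) (Ex 1 (Less 1 0))"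
      "sat P w (\<nu>(0 := d)) (input_at n)" by auto
    \<comment> \<open>Processes have no predecessor either, but \<open>input_at\<close> begins with
      a test for an action, which only positions pass.\<close>
    from d(3) obtain i where i: "d = Inr i" "i \<in> positions w" by (cases n) auto
    have "1 \<in> positions w" using positions_downward[OF i(2)] positions_ge_1[OF i(2)] by simp
    then have "i = 1"
      using d(2) i positions_ge_1[OF i(2)] by (force simp: ex_universe)
    then show ?R using d(3) i sat_input_at[of "\<nu>(0 := d)" i w P n] by simp
  next
    assume R: ?R
    then have 1: "1 \<in> positions w" using positions_downward[of "1 + n" w 1] by simp
    have "sat P w (\<nu>(0 := Inr 1)) (input_at n)"
      using R sat_input_at[of "\<nu>(0 := Inr 1)" 1 w P n] 1 by simp
    moreover have "\<not> sat P w (\<nu>(0 := Inr 1)) (Ex 1 (Less 1 0))"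
      using positions_ge_1 by (fastforce simp: ex_universe)
    moreover have "Inr 1 \<in> universe P w" using 1 by (simp add: universe_def InrI)
    ultimately show ?L unfolding sat.simps(7,8) by blast
  qed
  have "sat P w \<nu> (input_fm n) \<longleftrightarrow> has_env w \<or> (\<forall>k<n. 1 + k \<in> positions w \<and> fst (letter w (1 + k)) = 1) \<and>
       1 + n \<in> positions w \<and> fst (letter w (1 + n)) = 2" for \<nu>
    using first[of \<nu>] unfolding input_fm_def by (simp add: sat_env_fm)
  then show ?thesis
    using positions_downward[of "Suc n" w] by (auto simp: models_def)
qed

section \<open>Formulas for the counter machine\<close>

context counter_game
begin

definition some_act :: "(nat \<Rightarrow> bool) \<Rightarrow> nat \<Rightarrow> fm" where
  "some_act Q x = disj (map (\<lambda>a. Act a x) (filter Q acts))"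

text \<open>With the increments or decrements of a counter for \<open>Q\<close>, this places the
  process of the current event in \<open>inced\<close> or \<open>deced\<close> of the events before
  it.\<close>

definition earlier_fm :: "(nat \<Rightarrow> bool) \<Rightarrow> fm" where
  "earlier_fm Q = Ex 1 (fm_and (Less 1 0) (fm_and (Sim 1 0) (some_act Q 1)))"

text \<open>The alphabet may contain system actions outside \<open>acts\<close>. Testing both
  neighbours against \<open>acts\<close> excludes these as well as events of Environment.\<close>

definition follow_fm :: fm where
  "follow_fm = fm_all 0 (fm_all 1 (fm_imp (Succ 0 1)
     (disj (map (\<lambda>a. fm_and (Act a 0) (some_act (\<lambda>b. tgt a = src b) 1)) acts))))"

text \<open>The word may continue after \<open>q\<^sub>f\<close> is reached; an accepting run is
  then cut off at such a position.\<close>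

definition halt_fm :: fm where
  "halt_fm = Ex 0 (some_act (\<lambda>a. tgt a = q\<^sub>f) 0)"

definition once_fm :: "(nat \<Rightarrow> bool) \<Rightarrow> fm" where
  "once_fm Q = fm_all 0 (fm_imp (some_act Q 0) (Neg (earlier_fm Q)))"

definition dec_fm :: fm where
  "dec_fm = conj (map (\<lambda>a. fm_all 0 (fm_imp (Act a 0) (earlier_fm (\<lambda>b. \<exists>c. opn a = CDec c \<and> opn b = CInc c))))
     (filter (\<lambda>a. \<exists>c. opn a = CDec c) acts))"

definition after_fm :: "nat \<Rightarrow> fm" where
  "after_fm a = Ex 1 (fm_and (Succ 1 0) (Act a 1))"

text \<open>A challenged process with an earlier increment must have an earlier decrement, so it is
  not live. The counter is quantified outside the logic: if \<open>a\<close> is no zero test, the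
  premise is an empty disjunction and the implication holds.\<close>

definition zero_fm :: fm where
  "zero_fm = conj (map (\<lambda>a. fm_all 0 (fm_imp (Act 0 0) (fm_imp (after_fm a)
     (fm_imp (earlier_fm (\<lambda>b. \<exists>c. opn a = CZero c \<and> opn b = CInc c))
       (earlier_fm (\<lambda>b. \<exists>c. opn a = CZero c \<and> opn b = CDec c)))))) acts)"

text \<open>\<open>zero_fm\<close> stands outside the disjunction: a move of Environment releases
  System from all other conditions, but not from a refuted zero test.\<close>

definition machine_fm :: fm where
  "machine_fm = fm_and zero_fm (Or env_fm (conj [follow_fm, halt_fm,
     once_fm (\<lambda>a. \<exists>c. opn a = CInc c), once_fm (\<lambda>a. \<exists>c. opn a = CDec c), dec_fm]))"

lemmas fm_defs = follow_fm_def halt_fm_def once_fm_def dec_fm_def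
  after_fm_def zero_fm_def machine_fm_def env_fm_def

lemma some_act_props:
  "vars (some_act Q x) \<subseteq> {0, x}" "free_vars (some_act Q x) \<subseteq> {x}" "actions (some_act Q x) \<subseteq> set acts"
  by (auto simp: some_act_def)

lemma earlier_fm_props:
  "vars (earlier_fm Q) \<subseteq> {0, 1}" "free_vars (earlier_fm Q) \<subseteq> {0}" "actions (earlier_fm Q) \<subseteq> set acts"
  using some_act_props[of Q 1] by (auto simp: earlier_fm_def)

lemma vars_machine_fm: "vars machine_fm \<subseteq> {0, 1}"
  unfolding fm_defs using some_act_props(1) earlier_fm_props(1) by simp blast

lemma free_vars_machine_fm: "free_vars machine_fm = {}"
  unfolding fm_defs using some_act_props(2) earlier_fm_props(2) by simp blast

lemma actions_machine_fm: "actions machine_fm = insert 0 (set acts)"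
proof
  show "actions machine_fm \<subseteq> insert 0 (set acts)"
    unfolding fm_defs using some_act_props(3) earlier_fm_props(3) by simp blast
  show "insert 0 (set acts) \<subseteq> actions machine_fm"
    by (auto simp: machine_fm_def env_fm_def follow_fm_def)
qed

section \<open>Meaning of the formulas\<close>

text \<open>The prefix includes the zero test itself, which does not change the live
  processes.\<close>

definition unchallenged :: "'p event word \<Rightarrow> bool" where
  "unchallenged w \<longleftrightarrow> (\<forall>j c. j \<in> positions w \<longrightarrow> Suc j \<in> positions w \<longrightarrow> fst (letter w (Suc j)) = 0 \<longrightarrow>
     fst (letter w j) \<in> set acts \<longrightarrow> opn (fst (letter w j)) = CZero c \<longrightarrow>
     snd (letter w (Suc j)) \<notin> live c (prefix w j))"

definition simulates_run :: "'p event word \<Rightarrow> bool" where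
  "simulates_run w \<longleftrightarrow>
     (\<forall>i. i \<in> positions w \<longrightarrow> Suc i \<in> positions w \<longrightarrow>
       fst (letter w i) \<in> set acts \<and> fst (letter w (Suc i)) \<in> set acts \<and>
       tgt (fst (letter w i)) = src (fst (letter w (Suc i)))) \<and>
     (\<exists>i\<in>positions w. fst (letter w i) \<in> set acts \<and> tgt (fst (letter w i)) = q\<^sub>f) \<and>
     (\<forall>i\<in>positions w. fst (letter w i) \<in> set acts \<longrightarrow>
       wellformed (prefix w (i - 1)) (fst (letter w i)) (snd (letter w i)))"

context
  fixes As :: "nat set" and P :: "'p procs" and w :: "'p event word"
  assumes ex: "execution As {0} P w"
begin

lemma sat_some_act:
  "\<nu> x = Inr i \<Longrightarrow> i \<in> positions w \<Longrightarrow>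
    sat P w \<nu> (some_act Q x) \<longleftrightarrow> fst (letter w i) \<in> set acts \<and> Q (fst (letter w i))"
  by (auto simp: some_act_def)

lemma not_sat_some_act: "\<nu> x = Inl p \<Longrightarrow> \<not> sat P w \<nu> (some_act Q x)"
  by (auto simp: some_act_def)

lemma sat_earlier:
  assumes "\<nu> 0 = Inr i" "i \<in> positions w"
  shows "sat P w \<nu> (earlier_fm Q) \<longleftrightarrow>
    (\<exists>a\<in>set acts. Q a \<and> (a, snd (letter w i)) \<in> set (prefix w (i - 1)))"
proof -
  have "sat P w \<nu> (earlier_fm Q) \<longleftrightarrow> (\<exists>j\<in>positions w. j < i \<and> snd (letter w j) = snd (letter w i) \<and>
     fst (letter w j) \<in> set acts \<and> Q (fst (letter w j)))"
    using assms by (auto simp: earlier_fm_def ex_universe sat_some_act not_sat_some_act same_proc_positions[OF ex])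
  also have "\<dots> \<longleftrightarrow> (\<exists>a\<in>set acts. Q a \<and> (a, snd (letter w i)) \<in> set (prefix w (i - 1)))"
  proof
    assume "\<exists>j\<in>positions w. j < i \<and> snd (letter w j) = snd (letter w i) \<and>
     fst (letter w j) \<in> set acts \<and> Q (fst (letter w j))"
    then obtain j where j: "j \<in> positions w" "j < i" "snd (letter w j) = snd (letter w i)"
      "fst (letter w j) \<in> set acts" "Q (fst (letter w j))" by blast
    then have "(fst (letter w j), snd (letter w i)) \<in> set (prefix w (i - 1))"
      unfolding set_prefix by (intro image_eqI[of _ _ j]) (auto simp: prod_eq_iff)
    with j show "\<exists>a\<in>set acts. Q a \<and> (a, snd (letter w i)) \<in> set (prefix w (i - 1))" by blast
  next
    assume "\<exists>a\<in>set acts. Q a \<and> (a, snd (letter w i)) \<in> set (prefix w (i - 1))"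
    then obtain a j where "a \<in> set acts" "Q a" "j \<in> positions w" "j \<le> i - 1" "letter w j = (a, snd (letter w i))"
      unfolding set_prefix by (auto simp: image_iff)
    then show "\<exists>j\<in>positions w. j < i \<and> snd (letter w j) = snd (letter w i) \<and>
     fst (letter w j) \<in> set acts \<and> Q (fst (letter w j))"
      using positions_ge_1[OF assms(2)] by (intro bexI[of _ j]) auto
  qed
  finally show ?thesis .
qed

lemma sat_follow:
  "sat P w \<nu> follow_fm \<longleftrightarrow> (\<forall>i. i \<in> positions w \<longrightarrow> Suc i \<in> positions w \<longrightarrow>
     fst (letter w i) \<in> set acts \<and> fst (letter w (Suc i)) \<in> set acts \<and>
     tgt (fst (letter w i)) = src (fst (letter w (Suc i))))"
  by (auto simp: follow_fm_def ex_universe sat_some_act not_sat_some_act)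

lemma sat_halt:
  "sat P w \<nu> halt_fm \<longleftrightarrow> (\<exists>i\<in>positions w. fst (letter w i) \<in> set acts \<and> tgt (fst (letter w i)) = q\<^sub>f)"
  by (auto simp: halt_fm_def ex_universe sat_some_act not_sat_some_act)

lemma sat_once:
  "sat P w \<nu> (once_fm Q) \<longleftrightarrow> (\<forall>i\<in>positions w. fst (letter w i) \<in> set acts \<longrightarrow> Q (fst (letter w i)) \<longrightarrow>
     \<not> (\<exists>a\<in>set acts. Q a \<and> (a, snd (letter w i)) \<in> set (prefix w (i - 1))))"
  by (auto simp: once_fm_def ex_universe sat_some_act not_sat_some_act sat_earlier)

lemma sat_dec:
  "sat P w \<nu> dec_fm \<longleftrightarrow> (\<forall>i\<in>positions w. fst (letter w i) \<in> set acts \<longrightarrow> (\<forall>c. opn (fst (letter w i)) = CDec c \<longrightarrow>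
     (\<exists>a\<in>set acts. opn a = CInc c \<and> (a, snd (letter w i)) \<in> set (prefix w (i - 1)))))"
  by (auto simp: dec_fm_def ex_universe sat_earlier)

lemma sat_zero: "sat P w \<nu> zero_fm \<longleftrightarrow> unchallenged w"
proof -
  have after: "sat P w \<nu> (after_fm a) \<longleftrightarrow>
      (\<exists>j\<in>positions w. i = Suc j \<and> fst (letter w j) = a)"
    if "\<nu> 0 = Inr i" "i \<in> positions w" for \<nu> :: "nat \<Rightarrow> 'p + nat" and i a
    using that by (auto simp: after_fm_def ex_universe)
  let ?E = "\<lambda>i Q. \<exists>b\<in>set acts. Q b \<and> (b, snd (letter w i)) \<in> set (prefix w (i - 1))"
  have point: "sat P w (\<nu>(0 := Inr i)) (fm_imp (Act 0 0) (fm_imp (after_fm a) (fm_imp (earlier_fm Q) (earlier_fm R))))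
      \<longleftrightarrow> (fst (letter w i) = 0 \<longrightarrow> (\<exists>j\<in>positions w. i = Suc j \<and> fst (letter w j) = a) \<longrightarrow> ?E i Q \<longrightarrow> ?E i R)"
    if i: "i \<in> positions w" for i a Q R
  proof -
    have \<nu>: "(\<nu>(0 := Inr i)) 0 = Inr i" by simp
    have act: "sat P w (\<nu>(0 := Inr i)) (Act 0 0) \<longleftrightarrow> fst (letter w i) = 0" using i by auto
    show ?thesis
      unfolding sat.simps(7,8) act after[of "\<nu>(0 := Inr i)", OF \<nu> i] sat_earlier[of "\<nu>(0 := Inr i)", OF \<nu> i] imp_conv_disj by (rule refl)
  qed
  have "sat P w \<nu> zero_fm \<longleftrightarrow> (\<forall>a\<in>set acts. \<forall>i\<in>positions w. sat P w (\<nu>(0 := Inr i))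
     (fm_imp (Act 0 0) (fm_imp (after_fm a) (fm_imp (earlier_fm (\<lambda>b. \<exists>c. opn a = CZero c \<and> opn b = CInc c))
       (earlier_fm (\<lambda>b. \<exists>c. opn a = CZero c \<and> opn b = CDec c))))))"
    by (auto simp: zero_fm_def ex_universe)
  also have "\<dots> \<longleftrightarrow> (\<forall>a\<in>set acts. \<forall>i\<in>positions w. fst (letter w i) = 0 \<longrightarrow>
     (\<exists>j\<in>positions w. i = Suc j \<and> fst (letter w j) = a) \<longrightarrow>
     ?E i (\<lambda>b. \<exists>c. opn a = CZero c \<and> opn b = CInc c) \<longrightarrow> ?E i (\<lambda>b. \<exists>c. opn a = CZero c \<and> opn b = CDec c))"
    by (intro ball_cong refl point)
  also have "\<dots> \<longleftrightarrow> unchallenged w" (is "?L \<longleftrightarrow> _")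
  proof
    assume L: ?L
    show "unchallenged w"
      unfolding unchallenged_def
    proof (intro allI impI notI)
      fix j c assume j: "j \<in> positions w" "Suc j \<in> positions w" "fst (letter w (Suc j)) = 0"
        "fst (letter w j) \<in> set acts" "opn (fst (letter w j)) = CZero c"
        "snd (letter w (Suc j)) \<in> live c (prefix w j)"
      then have "?E (Suc j) (\<lambda>b. opn b = CDec c)"
        using bspec[OF bspec[OF L j(4)] j(2)] by (auto simp: live_def inced_def)
      then show False using j(6) by (auto simp: live_def deced_def)
    qed
  next
    assume R: "unchallenged w"
    show ?L
    proof (intro ballI impI)
      fix a i assume a: "a \<in> set acts" "i \<in> positions w" "fst (letter w i) = 0"
        "\<exists>j\<in>positions w. i = Suc j \<and> fst (letter w j) = a"
        "?E i (\<lambda>b. \<exists>c. opn a = CZero c \<and> opn b = CInc c)"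
      from a(4) obtain j where j': "j \<in> positions w" "i = Suc j" "fst (letter w j) = a" by blast
      from a(5) obtain c where "opn a = CZero c" "snd (letter w i) \<in> inced c (prefix w j)"
        unfolding inced_def j'(2) diff_Suc_1 by blast
      note j = j' this
      have "snd (letter w i) \<notin> live c (prefix w j)"
        using R a j unfolding unchallenged_def by blast
      then have "snd (letter w i) \<in> deced c (prefix w j)" using j(5) by (simp add: live_def)
      then show "?E i (\<lambda>b. \<exists>c. opn a = CZero c \<and> opn b = CDec c)"
        using j by (auto simp: deced_def)
    qed
  qed
  finally show ?thesis .
qed

lemma models_machine_fm:
  "models P w machine_fm \<longleftrightarrow> unchallenged w \<and> (has_env w \<or> simulates_run w)"
proof -
  \<comment> \<open>\<open>wellformed\<close> at all positions amounts to three conditions on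
    processes: no second increment, no second decrement, and no decrement without an earlier
    increment of the same counter.\<close>
  have wf: "(\<forall>i\<in>positions w. fst (letter w i) \<in> set acts \<longrightarrow>
       wellformed (prefix w (i - 1)) (fst (letter w i)) (snd (letter w i))) \<longleftrightarrow>
     sat P w \<nu> (once_fm (\<lambda>a. \<exists>c. opn a = CInc c)) \<and> sat P w \<nu> (once_fm (\<lambda>a. \<exists>c. opn a = CDec c)) \<and>
     sat P w \<nu> dec_fm" for \<nu>
    unfolding sat_once sat_dec wellformed_def inced_def deced_def by blast
  have "sat P w \<nu> machine_fm \<longleftrightarrow> unchallenged w \<and> (has_env w \<or> simulates_run w)" for \<nu>
    unfolding machine_fm_def simulates_run_def wf[of \<nu>] sat_follow[of \<nu>, symmetric] sat_halt[of \<nu>, symmetric]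
    by (simp add: sat_zero sat_env_fm) blast
  then show ?thesis by (simp add: models_def)
qed

end

end

section \<open>Correctness of the reduction\<close>

text \<open>Only the second conjunct depends on \<open>n\<close>, so the code of a query is easily
  computed from \<open>n\<close> and the code of \<open>\<phi>\<close>.\<close>

definition synthesis_query :: "fm \<Rightarrow> nat \<Rightarrow> fm" where
  "synthesis_query \<phi> n = fm_and \<phi> (input_fm n)"

lemma models_synthesis_query:
  "models P w (synthesis_query \<phi> n) \<longleftrightarrow> models P w \<phi> \<and> models P w (input_fm n)"
  by (auto simp: models_def synthesis_query_def)

context counter_game
begin

text \<open>While Environment stays silent, the formula forces every condition except the zero
  tests. At a wrong zero test Environment could challenge a live process instead. Up to the
  challenge both plays agree, so \<open>f\<close> would also admit the play that it loses.\<close>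

lemma win_imp_accepting:
  fixes P :: "'p procs"
  assumes As: "0 \<notin> As" and P: "P Sys = {}" "P Env = {}"
    and f: "strategy As {0} P f" "winning As {0} P (synthesis_query machine_fm n) f"
  shows "\<exists>u :: 'p event list. accepting n u"
proof -
  have win: "models P w machine_fm \<and> models P w (input_fm n)"
    if "execution As {0} P w" "compatible As P f w" "fair As P f w" for w
    using f(2) that unfolding winning_def models_synthesis_query by blast
  obtain w where w: "execution As {0} P w" "compatible As P f w" "fair As P f w"
    "\<And>i. i \<in> positions w \<Longrightarrow> letter w i \<in> sys_events As P"
  proof (rule fair_continuation[OF f(1), of "[]"])
    fix w assume w: "execution As {0} P w" "compatible As P f w" "fair As P f w"
      "\<And>i. i \<in> positions w \<Longrightarrow> length ([] :: 'p event list) < i \<Longrightarrow> letter w i \<in> sys_events As P"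
    show thesis
      by (rule that[OF w(1-3)]) (use w(4) positions_ge_1[of _ w] in \<open>fastforce simp: Suc_le_eq\<close>)
  qed simp_all
  let ?A = "\<lambda>i. fst (letter w i)"
  have "\<not> has_env w" using w(4) As by (force simp: has_env_def sys_events_def)
  then have run: "simulates_run w"
    and inp: "Suc n \<in> positions w" "\<And>k. k < n \<Longrightarrow> ?A (Suc k) = 1" "?A (Suc n) = 2"
    using win[OF w(1-3)] models_machine_fm[OF w(1)] models_input_fm[of P w n] by auto
  have follow: "?A i \<in> set acts \<and> ?A (Suc i) \<in> set acts \<and> tgt (?A i) = src (?A (Suc i))"
    if "i \<in> positions w" "Suc i \<in> positions w" for i
    using run that by (simp add: simulates_run_def)
  have wf: "wellformed (prefix w i) (?A (Suc i)) (snd (letter w (Suc i)))"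
    if "Suc i \<in> positions w" "?A (Suc i) \<in> set acts" for i
    using run that unfolding simulates_run_def by fastforce
  have A1: "?A 1 \<in> set acts" using inp acts by (cases n) auto
  have A: "?A i \<in> set acts" if i: "i \<in> positions w" for i
  proof (cases "i = 1")
    case False
    then obtain j where j: "i = Suc j" "1 \<le> j" using positions_ge_1[OF i] by (cases i) auto
    then show ?thesis using follow[of j] i positions_downward[OF i, of j] by simp
  qed (use A1 in simp)
  obtain h where h: "h \<in> positions w" "tgt (?A h) = q\<^sub>f" using run by (auto simp: simulates_run_def)
  \<comment> \<open>The first \<open>n\<close> positions carry action 1, whose target 0 is not
    \<open>q\<^sub>f\<close>.\<close>
  have "n < h"
  proof (rule ccontr)
    assume "\<not> n < h"
    then have "?A h = 1" using inp(2)[of "h - 1"] positions_ge_1[OF h(1)] by simp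
    then show False using h(2) tr_load final_nonzero by simp
  qed
  have pos: "Suc i \<in> positions w" if "i < h" for i using positions_downward[OF h(1)] that by simp
  let ?u = "prefix w h"
  have len: "length ?u = h" using length_prefix h(1) by blast
  have nth: "?u ! i = letter w (Suc i)" if "i < h" for i using prefix_nth pos[OF that] that by (metis Suc_leI)
  have zero: "live c (prefix w i) = {}" if i: "i < h" and z: "opn (?A (Suc i)) = CZero c" for i c
  proof (rule ccontr)
    let ?x = "prefix w (Suc i)"
    note posi = pos[OF i]
    assume "live c (prefix w i) \<noteq> {}"
    then obtain p where p: "p \<in> live c (prefix w i)" by blast
    have pp: "p \<in> live c ?x"
      using p z A[OF posi] by (cases "letter w (Suc i)") (auto simp: prefix_Suc[OF posi] live_def inced_snoc deced_snoc)
    have lenx: "length ?x = Suc i" using length_prefix posi by blast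
    have nthx: "?x ! k = letter w (Suc k)" if "k < Suc i" for k
      using that i by (intro prefix_nth pos) auto
    have setx: "set ?x \<subseteq> sys_events As P" using w(4) by (auto simp: set_prefix)
    have "p \<in> snd ` set ?x" using pp inced_subset[of c ?x] by (auto simp: live_def)
    \<comment> \<open>There are no processes of type \<open>Sys\<close>, so a process with a system
      event is shared and Environment may act on it.\<close>
    then have pP: "p \<in> P SysEnv" using setx P by (force simp: sys_events_def)
    have e: "set (?x @ [(0, p)]) \<subseteq> events As {0} P"
      using setx pP by (auto simp: events_def env_events_def)
    \<comment> \<open>The challenge is no system event because 0 is not in \<open>As\<close>; all
      letters before it are those of \<open>w\<close>, which obeys \<open>f\<close>.\<close>
    have c: "f (take k (?x @ [(0, p)])) = Some ((?x @ [(0, p)]) ! k)"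
      if k: "k < length (?x @ [(0, p)])" "(?x @ [(0, p)]) ! k \<in> sys_events As P" for k
    proof -
      have "k < Suc i"
      proof (rule ccontr)
        assume "\<not> k < Suc i"
        then have "(?x @ [(0, p)]) ! k = (0, p)" using k(1) lenx by (simp add: nth_append)
        then show False using k(2) As by (simp add: sys_events_def)
      qed
      then have "take k (?x @ [(0, p)]) = prefix w k" "(?x @ [(0, p)]) ! k = letter w (Suc k)" "Suc k \<in> positions w"
        using lenx nthx pos i by (auto simp: take_prefix nth_append)
      then show ?thesis using w(2,4) unfolding compatible_def by (metis diff_Suc_1)
    qed
    from fair_continuation[OF f(1) e c] obtain y where y: "execution As {0} P y" "compatible As P f y" "fair As P f y"
      "Suc (Suc i) \<in> positions y" "prefix y (Suc (Suc i)) = ?x @ [(0, p)]"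
      using lenx by auto
    have y1: "Suc i \<in> positions y" using positions_downward[OF y(4)] by simp
    have py: "prefix y (Suc i) = ?x" using take_prefix[of "Suc i" "Suc (Suc i)" y] y(5) lenx by simp
    have l1: "letter y (Suc (Suc i)) = (0, p)" using prefix_nth[of "Suc i" "Suc (Suc i)" y] y(4,5) lenx by (simp add: nth_append)
    have l2: "letter y (Suc i) = letter w (Suc i)" using prefix_nth[of i "Suc i" y] y1 py nthx[of i] by simp
    have "unchallenged y" using win[OF y(1-3)] models_machine_fm[OF y(1)] by simp
    then have "p \<notin> live c (prefix y (Suc i))"
      unfolding unchallenged_def using y1 y(4) l1 l2 A[OF posi] z by fastforce
    then show False using pp py by simp
  qed
  have "legal ?u"
    unfolding legal_def using A wf zero pos by (simp add: len nth take_prefix)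
  moreover have "chained ?u"
    unfolding chained_def using follow pos by (simp add: len nth)
  moreover have "loads n ?u"
    unfolding loads_def using \<open>n < h\<close> inp by (simp add: len nth)
  moreover have "last ?u = letter w h"
    using nth[of "h - 1"] len \<open>n < h\<close> last_conv_nth[of ?u] by fastforce
  ultimately show ?thesis using h(2) by (auto simp: accepting_def)
qed

text \<open>System replays \<open>u\<close> and falls silent once the history is no longer a proper
  prefix of \<open>u\<close>. Zero tests in \<open>u\<close> are genuine, so no challenge succeeds;
  if Environment never moves, the only fair play is \<open>u\<close> itself.\<close>

lemma accepting_imp_win:
  fixes u :: "nat event list"
  assumes As: "0 \<notin> As" "set acts \<subseteq> As" and u: "accepting n u" "snd ` set u \<subseteq> {..<length u}"
  shows "(0, 0, length u) \<in> Win As {0} (synthesis_query machine_fm n)"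
proof -
  define P :: "nat procs" where "P = (\<lambda>\<theta>. if \<theta> = SysEnv then {..<length u} else {})"
  define f where "f x = (if length x < length u \<and> x = take (length x) u then Some (u ! length x) else None)" for x
  have leg: "legal u" and ch: "chained u" and ld: "loads n u" and fin: "tgt (fst (last u)) = q\<^sub>f"
    using u(1) by (auto simp: accepting_def)
  have act: "fst (u ! i) \<in> set acts" if "i < length u" for i using leg that by (simp add: legal_def)
  have "process_triple P" by (simp add: process_triple_def P_def)
  moreover have strat: "strategy As {0} P f"
    unfolding strategy_def
  proof
    fix x
    have "u ! i \<in> sys_events As P" if "i < length u" for i
    proof -
      have "snd (u ! i) < length u" using u(2) that nth_mem by fastforce
      then show ?thesis using act[OF that] As(2) by (cases "u ! i") (auto simp: sys_events_def P_def)
    qed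
    then show "f x \<in> Some ` sys_events As P \<union> {None}" by (simp add: f_def)
  qed
  moreover have "winning As {0} P (synthesis_query machine_fm n) f"
    unfolding winning_def
  proof (intro allI impI, elim conjE)
    fix w assume w: "execution As {0} P w" "compatible As P f w" "fair As P f w"
    have sys: "letter w i \<in> sys_events As P" if "i \<in> positions w" "fst (letter w i) \<noteq> 0" for i
      using w(1) that by (force simp: execution_def events_def env_events_def)
    \<comment> \<open>An event other than action 0 was prescribed by \<open>f\<close>, so the
      history before it is a prefix of \<open>u\<close>. This holds in plays with moves of
      Environment too.\<close>
    have step: "i < length u \<and> prefix w i = take i u \<and> letter w (Suc i) = u ! i"
      if "Suc i \<in> positions w" "fst (letter w (Suc i)) \<noteq> 0" for i
    proof -
      have l: "length (prefix w i) = i"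
        using length_prefix[of i w] positions_downward[OF that(1), of i] by (cases i) auto
      have "f (prefix w i) = Some (letter w (Suc i))"
        using w(2) sys[OF that] that(1) unfolding compatible_def by fastforce
      then show ?thesis using l by (auto simp: f_def split: if_splits)
    qed
    have "unchallenged w"
      unfolding unchallenged_def
    proof (intro allI impI)
      fix j c assume j: "j \<in> positions w" "fst (letter w j) \<in> set acts" "opn (fst (letter w j)) = CZero c"
      obtain i where i: "j = Suc i" using positions_ge_1[OF j(1)] by (cases j) auto
      have s: "i < length u" "prefix w i = take i u" "letter w (Suc i) = u ! i"
        using step[of i] j i acts(1) by metis+
      have "live c (take i u) = {}" using leg s j i by (simp add: legal_def)
      moreover have "live c (prefix w j) = live c (prefix w i)"
        using j i by (cases "letter w j") (auto simp: prefix_Suc live_def inced_snoc deced_snoc)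
      ultimately show "snd (letter w (Suc j)) \<notin> live c (prefix w j)" using s by simp
    qed
    moreover have "has_env w \<or> w = Fin u"
    proof (rule disjCI)
      assume w0: "w \<noteq> Fin u"
      show "has_env w"
      proof (rule ccontr)
        assume "\<not> has_env w"
        then have step': "i < length u \<and> prefix w i = take i u \<and> letter w (Suc i) = u ! i"
          if "Suc i \<in> positions w" for i using step that by (auto simp: has_env_def)
        show False
        proof (cases w)
          case (Fin x)
          have len: "length x \<le> length u" using step'[of "length x - 1"] by (cases x) (auto simp: Fin)
          moreover have "x = take (length x) u"
          proof (rule nth_equalityI)
            show "length x = length (take (length x) u)" using len by simp
            fix i assume "i < length x"
            then show "x ! i = take (length x) u ! i" using step'[of i] by (simp add: Fin)
          qed
          \<comment> \<open>A proper prefix of \<open>u\<close> is unfair, since \<open>f\<close>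
            still prescribes a move there.\<close>
          ultimately show False using w(3) w0 by (auto simp: Fin f_def split: if_splits)
        next
          case (Inf v)
          then show False using step'[of "length u"] by simp
        qed
      qed
    qed
    moreover have "simulates_run w \<and> models P w (input_fm n)" if w: "w = Fin u"
    proof
      have "u \<noteq> []" using ld by (auto simp: loads_def)
      show "simulates_run w"
        unfolding simulates_run_def
      proof (intro conjI)
        show "\<forall>i. i \<in> positions w \<longrightarrow> Suc i \<in> positions w \<longrightarrow>
           fst (letter w i) \<in> set acts \<and> fst (letter w (Suc i)) \<in> set acts \<and>
           tgt (fst (letter w i)) = src (fst (letter w (Suc i)))"
        proof (intro allI impI)
          fix i assume i: "i \<in> positions w" "Suc i \<in> positions w"
          then obtain k where k: "i = Suc k" "Suc k < length u" by (cases i) (auto simp: w)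
          show "fst (letter w i) \<in> set acts \<and> fst (letter w (Suc i)) \<in> set acts \<and>
           tgt (fst (letter w i)) = src (fst (letter w (Suc i)))"
            using k act[of k] act[of "Suc k"] ch by (simp add: w chained_def)
        qed
        show "\<exists>i\<in>positions w. fst (letter w i) \<in> set acts \<and> tgt (fst (letter w i)) = q\<^sub>f"
          using \<open>u \<noteq> []\<close> fin act[of "length u - 1"]
          by (intro bexI[of _ "length u"]) (auto simp: w last_conv_nth Suc_le_eq)
        show "\<forall>i\<in>positions w. fst (letter w i) \<in> set acts \<longrightarrow>
           wellformed (prefix w (i - 1)) (fst (letter w i)) (snd (letter w i))"
          using leg by (auto simp: w legal_def)
      qed
      show "models P w (input_fm n)"
        unfolding models_input_fm using ld by (auto simp: w loads_def)
    qed
    moreover have "models P w (input_fm n)" if "has_env w" using that by (simp add: models_input_fm)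
    ultimately show "models P w (synthesis_query machine_fm n)"
      unfolding models_synthesis_query models_machine_fm[OF w(1)] by blast
  qed
  moreover have "card (P Sys) = 0" "card (P Env) = 0" "card (P SysEnv) = length u" by (simp_all add: P_def)
  ultimately show ?thesis unfolding Win_def by blast
qed

lemma synthesis_yes_iff:
  assumes "0 \<notin> As" "set acts \<subseteq> As"
  shows "(As, {0}, synthesis_query machine_fm n) \<in> synthesis_yes {0} {0} UNIV \<longleftrightarrow>
    (\<exists>v. ((q\<^sub>0, (\<lambda>_. 0)(0 := n)), (q\<^sub>f, v)) \<in> (trans_rel machine)\<^sup>*)"
proof
  assume "(As, {0}, synthesis_query machine_fm n) \<in> synthesis_yes {0} {0} UNIV"
  then obtain P :: "nat procs" and f where P: "process_triple P" "card (P Sys) = 0" "card (P Env) = 0"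
    and f: "strategy As {0} P f" "winning As {0} P (synthesis_query machine_fm n) f"
    by (auto simp: synthesis_yes_def Win_def)
  from P have "P Sys = {}" "P Env = {}" by (simp_all add: process_triple_def)
  from win_imp_accepting[OF assms(1) this f] show "\<exists>v. ((q\<^sub>0, (\<lambda>_. 0)(0 := n)), (q\<^sub>f, v)) \<in> (trans_rel machine)\<^sup>*"
    using accepting_imp_path by blast
next
  assume "\<exists>v. ((q\<^sub>0, (\<lambda>_. 0)(0 := n)), (q\<^sub>f, v)) \<in> (trans_rel machine)\<^sup>*"
  then obtain u :: "nat event list" where "accepting n u" "snd ` set u \<subseteq> {..<length u}"
    using path_imp_accepting by blast
  from accepting_imp_win[OF assms this]
  show "(As, {0}, synthesis_query machine_fm n) \<in> synthesis_yes {0} {0} UNIV"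
    by (auto simp: synthesis_yes_def)
qed

end

text \<open>\<open>As\<close> may exceed the actions of \<open>\<phi>\<close>, because the diagonal
  argument derives the alphabet from the code of \<open>\<phi>\<close> alone. Actions 0, 1 and 2 are
  required to occur so that \<open>input_fm\<close> stays within any alphabet that suits
  \<open>\<phi>\<close>.\<close>

lemma halting_game:
  obtains \<phi> where "vars \<phi> \<subseteq> {0, 1}" "free_vars \<phi> = {}" "{0, 1, 2} \<subseteq> actions \<phi>"
    "\<And>As n. 0 \<notin> As \<Longrightarrow> actions \<phi> \<subseteq> insert 0 As \<Longrightarrow>
      (As, {0}, synthesis_query \<phi> n) \<in> synthesis_yes {0} {0} UNIV \<longleftrightarrow> (\<exists>z. computes g [n] z)"
proof -
  obtain T a b where T: "finite T" "\<And>n. (\<exists>z. computes g [n] z) \<longleftrightarrow>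
      (\<exists>v. ((a, (\<lambda>_. 0)(0 := n)), (b, v)) \<in> (trans_rel T)\<^sup>*)"
    using halting_counter_machine[of g] by blast
  obtain ts where ts: "set ts = T" using finite_list[OF T(1)] by blast
  \<comment> \<open>States are shifted by one to free state 0 for the loading phase; entry
    \<open>i\<close> of the list of transitions becomes action \<open>i + 3\<close>.\<close>
  define tr :: "nat \<Rightarrow> trans" where
    "tr k = (if k = 1 then (0, CInc 0, 0) else if k = 2 then (0, CNop, Suc a)
      else (case ts ! (k - 3) of (q, m, q') \<Rightarrow> (Suc q, m, Suc q')))" for k
  define acts where "acts = [1..<length ts + 3]"
  interpret counter_game tr acts "Suc a" "Suc b"
    by unfold_locales (auto simp: acts_def tr_def split: prod.splits)
  have "machine = (\<lambda>(q, m, q'). (Suc q, m, Suc q')) ` T"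
  proof -
    have "set acts - {1, 2} = (\<lambda>i. i + 3) ` {..<length ts}"
    proof (intro set_eqI iffI)
      fix x assume "x \<in> set acts - {1, 2}"
      then show "x \<in> (\<lambda>i. i + 3) ` {..<length ts}"
        by (intro image_eqI[of _ _ "x - 3"]) (auto simp: acts_def)
    qed (auto simp: acts_def)
    then have "machine = (\<lambda>i. tr (i + 3)) ` {..<length ts}"
      by (simp add: machine_def image_image)
    also have "\<dots> = (\<lambda>i. (\<lambda>(q, m, q'). (Suc q, m, Suc q')) (ts ! i)) ` {..<length ts}"
      by (simp add: tr_def)
    also have "\<dots> = (\<lambda>(q, m, q'). (Suc q, m, Suc q')) ` ((\<lambda>i. ts ! i) ` {..<length ts})"
      by (simp only: image_image)
    also have "(\<lambda>i. ts ! i) ` {..<length ts} = T"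
      using ts by (auto simp: set_conv_nth)
    finally show ?thesis .
  qed
  then have machine: "(q, m, q') \<in> machine \<longleftrightarrow> (\<exists>r r'. q = Suc r \<and> q' = Suc r' \<and> (r, m, r') \<in> T)" for q m q'
    by force
  have M: "((Suc a, v), (Suc b, v')) \<in> (trans_rel machine)\<^sup>* \<longleftrightarrow> ((a, v), (b, v')) \<in> (trans_rel T)\<^sup>*" for v v'
  proof
    assume "((Suc a, v), (Suc b, v')) \<in> (trans_rel machine)\<^sup>*"
    then have "((Suc a - 1, v), (Suc b - 1, v')) \<in> (trans_rel T)\<^sup>*"
      by (rule trans_rel_rtrancl_embed[where h = "\<lambda>q. q - 1"]) (auto simp: machine)
    then show "((a, v), (b, v')) \<in> (trans_rel T)\<^sup>*" by simp
  next
    assume "((a, v), (b, v')) \<in> (trans_rel T)\<^sup>*"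
    then show "((Suc a, v), (Suc b, v')) \<in> (trans_rel machine)\<^sup>*"
      by (rule trans_rel_rtrancl_embed) (auto simp: machine)
  qed
  show ?thesis
  proof (rule that[of machine_fm])
    show "{0, 1, 2} \<subseteq> actions machine_fm" using acts by (auto simp: actions_machine_fm)
    show "(As, {0}, synthesis_query machine_fm n) \<in> synthesis_yes {0} {0} UNIV \<longleftrightarrow> (\<exists>z. computes g [n] z)"
      if "0 \<notin> As" "actions machine_fm \<subseteq> insert 0 As" for As n
    proof -
      have "set acts \<subseteq> As" using that acts(1) by (auto simp: actions_machine_fm)
      from synthesis_yes_iff[OF that(1) this] show ?thesis by (simp only: M T(2))
    qed
  qed (rule vars_machine_fm free_vars_machine_fm)+
qed

section \<open>Diagonalisation\<close>

definition recursive1 :: "(nat \<Rightarrow> nat) \<Rightarrow> bool" where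
  "recursive1 h \<longleftrightarrow> (\<exists>r. \<forall>x. computes r [x] (h x))"

definition recursive2 :: "(nat \<Rightarrow> nat \<Rightarrow> nat) \<Rightarrow> bool" where
  "recursive2 h \<longleftrightarrow> (\<exists>r. \<forall>x y. computes r [x, y] (h x y))"

lemma computes_comp1: "computes g xs y \<Longrightarrow> computes f [y] z \<Longrightarrow> computes (RComp f [g]) xs z"
  by (rule computes.comp[of _ _ "[y]"]) auto

lemma computes_comp2:
  "computes g xs y \<Longrightarrow> computes h xs y' \<Longrightarrow> computes f [y, y'] z \<Longrightarrow> computes (RComp f [g, h]) xs z"
  by (rule computes.comp[of _ _ "[y, y']"]) auto

text \<open>One program serves argument lists of every length, since \<open>RZero\<close> accepts
  all of them.\<close>

lemma computes_const: "\<exists>r. \<forall>xs. computes r xs c"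
proof (induction c)
  case 0
  show ?case using computes.zero by blast
next
  case (Suc c)
  then show ?case using computes_comp1 computes.succ by blast
qed

lemma recursive1_const: "recursive1 (\<lambda>_. c)"
  using computes_const unfolding recursive1_def by blast

lemma recursive1_id: "recursive1 (\<lambda>x. x)"
  using computes.proj[of 0 "[x]" for x] unfolding recursive1_def by auto

lemma recursive1_Suc: "recursive1 Suc"
  using computes.succ unfolding recursive1_def by blast

lemma recursive1_comp2:
  "recursive2 h \<Longrightarrow> recursive1 f \<Longrightarrow> recursive1 g \<Longrightarrow> recursive1 (\<lambda>x. h (f x) (g x))"
  unfolding recursive1_def recursive2_def using computes_comp2 by meson

lemma recursive2_fst: "recursive2 (\<lambda>x y. x)"
  using computes.proj[of 0 "[x, y]" for x y] unfolding recursive2_def by auto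

lemma recursive2_snd: "recursive2 (\<lambda>x y. y)"
  using computes.proj[of 1 "[x, y]" for x y] unfolding recursive2_def by auto

lemma recursive2_comp1: "recursive1 h \<Longrightarrow> recursive2 f \<Longrightarrow> recursive2 (\<lambda>x y. h (f x y))"
  unfolding recursive1_def recursive2_def using computes_comp1 by meson

lemma recursive2_comp2:
  "recursive2 h \<Longrightarrow> recursive2 f \<Longrightarrow> recursive2 g \<Longrightarrow> recursive2 (\<lambda>x y. h (f x y) (g x y))"
  unfolding recursive2_def using computes_comp2 by meson

text \<open>Primitive recursion without parameters: the base program is a constant applied to the
  empty list.\<close>

lemma recursive1_prec:
  assumes "recursive2 s" "\<And>n. h (Suc n) = s n (h n)"
  shows "recursive1 h"
proof -
  obtain r where r: "\<And>x y. computes r [x, y] (s x y)" using assms(1) unfolding recursive2_def by blast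
  obtain z where z: "\<And>xs. computes z xs (h 0)" using computes_const by blast
  have "computes (RPrec z r) [n] (h n)" for n
    by (induction n) (auto intro: computes.prec_0 computes.prec_Suc z r simp: assms(2))
  then show ?thesis unfolding recursive1_def by blast
qed

lemma recursive2_add: "recursive2 (+)"
proof -
  have "computes (RPrec (RProj 0) (RComp RSucc [RProj 1])) [x, y] (x + y)" for x y
  proof (induction x)
    case 0
    show ?case using computes.proj[of 0 "[y]"] by (auto intro: computes.prec_0)
  next
    case (Suc x)
    have "computes (RComp RSucc [RProj 1]) [x, x + y, y] (Suc (x + y))"
      using computes.proj[of 1 "[x, x + y, y]"] by (auto intro: computes_comp1 computes.succ)
    with Suc show ?case by (auto intro: computes.prec_Suc)
  qed
  then show ?thesis unfolding recursive2_def by blast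
qed

section \<open>Computability of the encoding\<close>

text \<open>The code of a pair is the triangular number of the sum plus the first component.\<close>

lemma recursive2_prod_encode: "recursive2 (\<lambda>x y. prod_encode (x, y))"
proof -
  have "recursive1 triangle"
  proof (rule recursive1_prec)
    show "recursive2 (\<lambda>n y. y + Suc n)"
      by (intro recursive2_comp2[OF recursive2_add] recursive2_comp1[OF recursive1_Suc] recursive2_fst recursive2_snd)
  qed simp
  then show ?thesis
    unfolding prod_encode_def split
    by (intro recursive2_comp2[OF recursive2_add] recursive2_comp1[of triangle] recursive2_fst recursive2_snd)
qed

lemmas recursive1_prod_encode = recursive1_comp2[OF recursive2_prod_encode]

lemma set_encode_atLeast1: "set_encode {1..n} + 2 = 2 ^ Suc n"
proof (induction n)
  case (Suc n)
  have "{1..Suc n} = insert (Suc n) {1..n}" by auto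
  then show ?case using Suc by (simp add: set_encode_insert)
qed simp

text \<open>The code is a power of two minus two, so going from \<open>n\<close> to
  \<open>Suc n\<close> doubles it and adds two. No power has to be computed.\<close>

lemma recursive1_set_encode_atLeast1: "recursive1 (\<lambda>n. set_encode {1..n})"
proof (rule recursive1_prec)
  show "recursive2 (\<lambda>n y. y + Suc (Suc y))"
    by (intro recursive2_comp2[OF recursive2_add] recursive2_comp1[OF recursive1_Suc] recursive2_snd)
  show "set_encode {1..Suc n} = set_encode {1..n} + Suc (Suc (set_encode {1..n}))" for n
    using set_encode_atLeast1[of n] set_encode_atLeast1[of "Suc n"] by simp
qed

lemma recursive1_input_code: "recursive1 (\<lambda>n. fm_code (input_fm n))"
proof -
  \<comment> \<open>\<open>s\<close> takes the code of \<open>input_at n\<close> to that of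
    \<open>input_at (Suc n)\<close>; the tags 6, 7 and 8 stand for negation, disjunction and
    quantifier.\<close>
  define s where "s y = prod_encode (6, prod_encode (7, prod_encode (prod_encode (6, fm_code (Act 1 0)),
    prod_encode (6, prod_encode (8, prod_encode (1, prod_encode (6, prod_encode (7,
    prod_encode (prod_encode (6, fm_code (Succ 0 1)), prod_encode (6, prod_encode (8,
    prod_encode (0, prod_encode (6, prod_encode (7, prod_encode (prod_encode (6, fm_code (Eq 0
    1)), prod_encode (6, y))))))))))))))))" for y
  have s: "recursive1 s"
    unfolding s_def by (intro recursive1_prod_encode recursive1_const recursive1_id)
  have "recursive1 (\<lambda>n. fm_code (input_at n))"
  proof (rule recursive1_prec)
    show "recursive2 (\<lambda>_ y. s y)" by (rule recursive2_comp1[OF s recursive2_snd])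
  qed (simp add: s_def)
  then show ?thesis
    unfolding input_fm_def fm_code.simps by (intro recursive1_prod_encode recursive1_const)
qed

text \<open>If \<open>e\<close> is the code of \<open>\<phi>\<close>, this is the code of the
  instance with system actions \<open>{1..e}\<close>, environment action 0 and formula
  \<open>synthesis_query \<phi> e\<close>. Formulas need not be decoded to compute it.\<close>

lemma recursive1_reduction:
  "recursive1 (\<lambda>e. prod_encode (set_encode {1..e}, prod_encode (set_encode {0},
     prod_encode (6, prod_encode (7, prod_encode (prod_encode (6, e), prod_encode (6, fm_code (input_fm e))))))))"
  by (intro recursive1_prod_encode recursive1_const recursive1_id recursive1_input_code recursive1_set_encode_atLeast1)

text \<open>A pair code is at least as large as its components. Hence \<open>{1..e}\<close> contains
  all actions other than 0 of the formula with code \<open>e\<close>.\<close>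

lemma actions_le_fm_code: "a \<in> actions \<phi> \<Longrightarrow> a \<le> fm_code \<phi>"
  by (induction \<phi>) (auto intro: order_trans[OF _ le_prod_encode_1] order_trans[OF _ le_prod_encode_2])

theorem theorem1: "\<not> synthesis_decidable FO2 {0} {0} UNIV"
proof
  assume "synthesis_decidable FO2 {0} {0} UNIV"
  then obtain D where D: "\<And>x. x \<in> synthesis_instances FO2 \<Longrightarrow>
      computes D [inst_code x] (if x \<in> synthesis_yes {0} {0} UNIV then 1 else 0)"
    unfolding synthesis_decidable_def decidable_def by blast
  obtain r where r: "\<And>e. computes r [e] (prod_encode (set_encode {1..e}, prod_encode (set_encode {0},
     prod_encode (6, prod_encode (7, prod_encode (prod_encode (6, e), prod_encode (6, fm_code (input_fm e))))))))"
    using recursive1_reduction unfolding recursive1_def by blast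
  \<comment> \<open>The value of \<open>d\<close> depends only on its second argument
    \<open>e\<close>, so minimisation over the first stops at once if the decision on the instance
    of \<open>e\<close> is 0 and never stops if it is 1.\<close>
  define d where "d = RComp D [RComp r [RProj 1]]"
  \<comment> \<open>There is no circularity: \<open>d\<close> is built from \<open>D\<close> and
    \<open>r\<close> only, and \<open>\<phi>\<close> describes the halting of \<open>RMin d\<close>
    for all inputs.\<close>
  obtain \<phi> where \<phi>: "vars \<phi> \<subseteq> {0, 1}" "free_vars \<phi> = {}" "{0, 1, 2} \<subseteq> actions \<phi>"
    "\<And>As n. 0 \<notin> As \<Longrightarrow> actions \<phi> \<subseteq> insert 0 As \<Longrightarrow>
      (As, {0}, synthesis_query \<phi> n) \<in> synthesis_yes {0} {0} UNIV \<longleftrightarrow> (\<exists>z. computes (RMin d) [n] z)"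
    using halting_game[of "RMin d"] by blast
  define e where "e = fm_code \<phi>"
  let ?x = "({1..e}, {0 :: nat}, synthesis_query \<phi> e)"
  have acts: "actions \<phi> \<subseteq> insert 0 {1..e}" using actions_le_fm_code[of _ \<phi>] by (fastforce simp: e_def)
  have yes: "?x \<in> synthesis_yes {0} {0} UNIV \<longleftrightarrow> (\<exists>z. computes (RMin d) [e] z)"
    using acts by (intro \<phi>(4)) auto
  \<comment> \<open>\<open>D\<close> is known to answer correctly on instances only.\<close>
  have "?x \<in> synthesis_instances FO2"
  proof -
    have "vars (synthesis_query \<phi> e) \<subseteq> {0, 1}"
      using \<phi>(1) input_at_props(1)[of e] by (auto simp: synthesis_query_def input_fm_def env_fm_def)
    then have "card (vars (synthesis_query \<phi> e)) \<le> card {0, 1 :: nat}" by (intro card_mono) auto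
    moreover have "free_vars (synthesis_query \<phi> e) = {}"
      using \<phi>(2) input_at_props(2)[of e] by (auto simp: synthesis_query_def input_fm_def env_fm_def)
    moreover have "actions (synthesis_query \<phi> e) \<subseteq> {1..e} \<union> {0}"
      using acts \<phi>(3) input_at_props(3)[of e] by (auto simp: synthesis_query_def input_fm_def env_fm_def)
    ultimately show ?thesis by (simp add: synthesis_instances_def FO2_def FO_def sentence_def)
  qed
  from D[OF this] have Dx: "computes D [inst_code ?x] (if ?x \<in> synthesis_yes {0} {0} UNIV then 1 else 0)" .
  have "computes (RComp r [RProj 1]) [m, e] (inst_code ?x)" for m
    using r[of e] computes.proj[of 1 "[m, e]"] by (auto simp: synthesis_query_def e_def intro: computes_comp1)
  then have d: "computes d [m, e] (if ?x \<in> synthesis_yes {0} {0} UNIV then 1 else 0)" for m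
    unfolding d_def using Dx by (rule computes_comp1)
  show False
  proof (cases "?x \<in> synthesis_yes {0} {0} UNIV")
    \<comment> \<open>The answer yes would mean that the search for the answer no succeeds.\<close>
    case True
    then obtain z where "computes (RMin d) [e] z" using yes by blast
    then have "computes d [z, e] 0" by (rule computes_RMinE)
    then show False using d[of z] True computes_deterministic by fastforce
  next
    case False
    then have "computes (RMin d) [e] 0" using d[of 0] by (auto intro: computes.min)
    then show False using yes False by blast
  qed
qed

end
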